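(* Let $\Delta^{n}$ be a ball centered at the origin $0$ in $\mathbb{C}^{n}$, let $F:\Delta^{n}\rightarrow\mathbb{C}^{n}$ be a holomorphic mapping such that $0$ is an isolated zero of $F$, and consider the system $$\dot{x}=\frac{dx}{dt}=F(x),\qquad x\in\Delta^{n},$$ with real time $t$. Suppose that the Jacobian matrix $F^{\prime}(0)$ has a nonzero pure imaginary eigenvalue $\omega i$ ($\omega\in\mathbb{R}$, $\omega\neq 0$) and that for any other eigenvalue $\lambda$ of $F^{\prime}(0)$, $$\lambda/(\omega i)\neq \pm 2,\pm 3,\dots .$$ Then there exists a complex analytic variety in $\Delta^{n}$ of pure complex dimension at least $1$, consisting of $0$ and periodic orbits of the system of the same period $\frac{2\pi}{|\omega|}$.
   Context: Time $t$ is real. A periodic orbit is a nonconstant periodic orbit, and the period of a periodic orbit always means its least positive period. "Complex analytic variety in $\Delta^{n}$" is understood locally: an analytic subset of some open neighborhood of $0$ contained in $\Delta^{n}$. "Pure dimension" means that the variety has the same complex dimension at every one of its points. "Consisting of $0$ and periodic orbits of the same period $\frac{2\pi}{|\omega|}$" means that the variety contains $0$ and that its complement of $\{0\}$ is a union of (entire) periodic orbits, each having least positive period $\frac{2\pi}{|\omega|}$. *)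

theory Defs
  imports "HOL-Analysis.Analysis"
begin

text \<open>Holomorphy in several variables: total (Frechet) differentiability with a
  complex-linear differential. It is only used on open sets.\<close>

definition holomorphic_fun_on :: "(complex ^ 'n \<Rightarrow> complex) \<Rightarrow> (complex ^ 'n) set \<Rightarrow> bool" where
  "holomorphic_fun_on f S \<longleftrightarrow>
     (\<forall>x\<in>S. \<exists>D. Vector_Spaces.linear (*s) (*) D \<and> (f has_derivative D) (at x))"

definition holomorphic_map_on ::
    "(complex ^ 'n \<Rightarrow> complex ^ 'm) \<Rightarrow> (complex ^ 'n) set \<Rightarrow> bool" where
  "holomorphic_map_on F S \<longleftrightarrow> (\<forall>i. holomorphic_fun_on (\<lambda>x. F x $ i) S)"

text \<open>The entry in row \<open>i\<close> and column \<open>j\<close> is the complex partial derivative of the \<open>i\<close>-th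
  component in the \<open>j\<close>-th variable.\<close>

definition jacobian_matrix ::
    "(complex ^ 'n \<Rightarrow> complex ^ 'm) \<Rightarrow> complex ^ 'n \<Rightarrow> complex ^ 'n ^ 'm" where
  "jacobian_matrix F a = (\<chi> i j. deriv (\<lambda>z. F (a + axis j z) $ i) 0)"

definition matrix_eigenvalue :: "complex ^ 'n ^ 'n \<Rightarrow> complex \<Rightarrow> bool" where
  "matrix_eigenvalue A l \<longleftrightarrow> (\<exists>v. v \<noteq> 0 \<and> A *v v = l *s v)"

definition isolated_zero_of :: "(complex ^ 'n \<Rightarrow> complex ^ 'm) \<Rightarrow> complex ^ 'n \<Rightarrow> bool" where
  "isolated_zero_of F a \<longleftrightarrow> F a = 0 \<and> (\<forall>\<^sub>F x in at a. F x \<noteq> 0)"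

text \<open>The condition at points \<open>p\<close> of \<open>U\<close> outside \<open>V\<close> makes \<open>V\<close> relatively closed in \<open>U\<close>.\<close>

definition analytic_subset :: "(complex ^ 'n) set \<Rightarrow> (complex ^ 'n) set \<Rightarrow> bool" where
  "analytic_subset U V \<longleftrightarrow> open U \<and> V \<subseteq> U \<and>
     (\<forall>p\<in>U. \<exists>W Fs. open W \<and> p \<in> W \<and> W \<subseteq> U \<and> finite Fs \<and>
        (\<forall>f\<in>Fs. holomorphic_fun_on f W) \<and> V \<inter> W = {x\<in>W. \<forall>f\<in>Fs. f x = 0})"

definition local_analytic_variety_in :: "(complex ^ 'n) set \<Rightarrow> (complex ^ 'n) set \<Rightarrow> bool" where
  "local_analytic_variety_in \<Delta> V \<longleftrightarrow>
     (\<exists>U. open U \<and> 0 \<in> U \<and> U \<subseteq> \<Delta> \<and> analytic_subset U V)"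

definition biholomorphic_on :: "(complex ^ 'n \<Rightarrow> complex ^ 'n) \<Rightarrow> (complex ^ 'n) set \<Rightarrow> bool" where
  "biholomorphic_on \<phi> W \<longleftrightarrow> holomorphic_map_on \<phi> W \<and> open (\<phi> ` W) \<and>
     (\<exists>\<psi>. holomorphic_map_on \<psi> (\<phi> ` W) \<and> (\<forall>x\<in>W. \<psi> (\<phi> x) = x))"

text \<open>Near \<open>q\<close> the set \<open>V\<close> is a \<open>d\<close>-dimensional complex submanifold: a holomorphic chart of
  the ambient space maps it to the coordinate subspace spanned by \<open>d\<close> coordinate axes.\<close>

definition regular_point :: "(complex ^ 'n) set \<Rightarrow> nat \<Rightarrow> complex ^ 'n \<Rightarrow> bool" where
  "regular_point V d q \<longleftrightarrow> q \<in> V \<and>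
     (\<exists>W \<phi> I. open W \<and> q \<in> W \<and> biholomorphic_on \<phi> W \<and> card I = d \<and>
        \<phi> ` (V \<inter> W) = {y \<in> \<phi> ` W. \<forall>i. i \<notin> I \<longrightarrow> y $ i = 0})"

text \<open>The dimension of \<open>V\<close> at \<open>p\<close> is the upper limit, as \<open>q\<close> tends to \<open>p\<close> through the regular
  points of \<open>V\<close>, of the dimension of \<open>V\<close> at \<open>q\<close>; as dimensions are integers, this is the largest
  \<open>d\<close> for which \<open>d\<close>-dimensional regular points accumulate at (or equal) \<open>p\<close>.\<close>

definition has_dimension_at :: "(complex ^ 'n) set \<Rightarrow> complex ^ 'n \<Rightarrow> nat \<Rightarrow> bool" where
  "has_dimension_at V p d \<longleftrightarrow>
     p \<in> closure {q. regular_point V d q} \<and>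
     (\<forall>d'>d. p \<notin> closure {q. regular_point V d' q})"

definition pure_dimensional :: "(complex ^ 'n) set \<Rightarrow> nat \<Rightarrow> bool" where
  "pure_dimensional V d \<longleftrightarrow> (\<forall>p\<in>V. has_dimension_at V p d)"

definition least_positive_period :: "(real \<Rightarrow> 'a) \<Rightarrow> real \<Rightarrow> bool" where
  "least_positive_period x T \<longleftrightarrow> T > 0 \<and> (\<forall>t. x (t + T) = x t) \<and>
     (\<forall>S. 0 < S \<and> S < T \<longrightarrow> \<not> (\<forall>t. x (t + S) = x t))"

definition global_solution ::
    "(complex ^ 'n) set \<Rightarrow> (complex ^ 'n \<Rightarrow> complex ^ 'n) \<Rightarrow> (real \<Rightarrow> complex ^ 'n) \<Rightarrow> bool" where
  "global_solution \<Delta> F x \<longleftrightarrow>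
     (\<forall>t. x t \<in> \<Delta> \<and> (x has_vector_derivative F (x t)) (at t))"

definition periodic_orbit ::
    "(complex ^ 'n) set \<Rightarrow> (complex ^ 'n \<Rightarrow> complex ^ 'n) \<Rightarrow> real \<Rightarrow> (complex ^ 'n) set \<Rightarrow> bool" where
  "periodic_orbit \<Delta> F T C \<longleftrightarrow>
     (\<exists>x. global_solution \<Delta> F x \<and> \<not> x constant_on UNIV \<and> least_positive_period x T \<and> C = range x)"

end

theory Submission
  imports Defs "HOL-Complex_Analysis.Conformal_Mappings"
begin

text \<open>The periodic orbits are read off an invariant holomorphic disc on which the flow is a rotation. Let
  \<open>v\<close> be an eigenvector of \<open>F'(0)\<close> for \<open>\<kappa> = \<omega>\<i>\<close> and look for a holomorphic curve \<open>g\<close> with \<open>g(0) = 0\<close>,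
  \<open>g'(0) = v\<close> and \<open>\<kappa> z g'(z) = F(g(z))\<close>; then \<open>t \<mapsto> g(c e\<^sup>i\<^sup>\<omega>\<^sup>t)\<close> solves the system for all small \<open>c\<close>. The
  coefficient of \<open>z\<^sup>k\<close>, \<open>k \<ge> 2\<close>, is determined by inverting \<open>F'(0) - k \<kappa>\<close>, which the hypothesis on
  the eigenvalues permits. Truncating at a large order \<open>m\<close>, the remainder \<open>w = O(z\<^sup>m)\<close> is a fixed point
  of a contraction: inverting \<open>\<kappa> z d/dz\<close> on \<open>O(z\<^sup>m)\<close> gains a factor \<open>1 / (m \<bar>\<kappa>\<bar>)\<close>, which beats
  the Lipschitz constant of \<open>F\<close>. Since \<open>v \<noteq> 0\<close>, a small disc is embedded as the graph of a holomorphic function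
  over one coordinate, hence is a one-dimensional complex submanifold.\<close>

subsection \<open>Holomorphic curves and maps\<close>

lemma norm_vector_smult_complex: "norm (c *s x) = cmod c * norm (x :: complex ^ 'n)"
  by (simp add: norm_vec_def norm_mult L2_set_right_distrib)

lemma clinear_iff:
  fixes D :: "complex ^ 'n \<Rightarrow> complex"
  shows "Vector_Spaces.linear (*s) (*) D \<longleftrightarrow>
    (\<forall>x y. D (x + y) = D x + D y) \<and> (\<forall>c x. D (c *s x) = c * D x)"
  by (auto simp: Vector_Spaces.linear_iff vec.vector_space_axioms vector_space_over_itself.vector_space_axioms)

lemma has_derivative_vec_componentwise:
  fixes f :: "'a::real_normed_vector \<Rightarrow> complex ^ 'n"
  assumes "\<And>i. ((\<lambda>x. f x $ i) has_derivative (\<lambda>h. D h $ i)) (at a)"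
  shows "(f has_derivative D) (at a)"
  unfolding has_derivative_componentwise_within[of f D a UNIV]
proof
  fix b :: "complex ^ 'n" assume "b \<in> Basis"
  then obtain i u where b: "b = axis i u" unfolding Basis_vec_def by auto
  show "((\<lambda>x. f x \<bullet> b) has_derivative (\<lambda>h. D h \<bullet> b)) (at a)"
    unfolding b inner_axis by (rule has_derivative_inner_left[OF assms])
qed

text \<open>Stated coordinate by coordinate, so that one-variable complex analysis applies to each
  component. \<open>has_curve_derivative_iff\<close> gives the Frechet form, which is the one suited
  to the chain rule.\<close>

definition has_curve_derivative ::
    "(complex \<Rightarrow> complex ^ 'n) \<Rightarrow> complex ^ 'n \<Rightarrow> complex \<Rightarrow> bool" where
  "has_curve_derivative g d z \<longleftrightarrow> (\<forall>i. ((\<lambda>w. g w $ i) has_field_derivative d $ i) (at z))"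

lemma has_curve_derivative_iff:
  "has_curve_derivative g d z \<longleftrightarrow> (g has_derivative (\<lambda>h. h *s d)) (at z)"
proof
  assume *: "has_curve_derivative g d z"
  show "(g has_derivative (\<lambda>h. h *s d)) (at z)"
  proof (rule has_derivative_vec_componentwise)
    fix i
    have "(\<lambda>h. (h *s d) $ i) = (*) (d $ i)" by (auto simp: mult.commute)
    then show "((\<lambda>x. g x $ i) has_derivative (\<lambda>h. (h *s d) $ i)) (at z)"
      using * by (simp add: has_curve_derivative_def has_field_derivative_def)
  qed
next
  assume *: "(g has_derivative (\<lambda>h. h *s d)) (at z)"
  show "has_curve_derivative g d z"
    unfolding has_curve_derivative_def has_field_derivative_def
  proof
    fix i
    have "(\<lambda>h. (h *s d) $ i) = (*) (d $ i)" by (auto simp: mult.commute)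
    then show "((\<lambda>w. g w $ i) has_derivative (*) (d $ i)) (at z)"
      using bounded_linear.has_derivative[OF bounded_linear_vec_nth *, of i] by simp
  qed
qed

text \<open>Since the differential \<open>D\<close> of \<open>f\<close> is complex linear, the chain
  rule yields \<open>h \<mapsto> D (h *s d) = h * D d\<close>, which is multiplication by a complex
  number and hence a complex derivative.\<close>

lemma holomorphic_on_compose_curve:
  assumes "holomorphic_fun_on f S" "open T" "\<And>z. z \<in> T \<Longrightarrow> g z \<in> S"
    and "\<And>i. (\<lambda>z. g z $ i) holomorphic_on T"
  shows "(\<lambda>z. f (g z)) holomorphic_on T"
  unfolding holomorphic_on_open[OF \<open>open T\<close>]
proof
  fix z assume z: "z \<in> T"
  define d where "d = (\<chi> i. deriv (\<lambda>z. g z $ i) z)"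
  have "has_curve_derivative g d z"
    unfolding has_curve_derivative_def d_def
    using holomorphic_derivI[OF assms(4) \<open>open T\<close> z] by simp
  then have g: "(g has_derivative (\<lambda>h. h *s d)) (at z)" by (simp add: has_curve_derivative_iff)
  obtain D where D: "Vector_Spaces.linear (*s) (*) D" "(f has_derivative D) (at (g z))"
    using assms(1,3) z unfolding holomorphic_fun_on_def by blast
  have "((\<lambda>x. f (g x)) has_derivative (\<lambda>h. D (h *s d))) (at z)"
    by (rule has_derivative_compose[OF g D(2)])
  moreover have "(\<lambda>h. D (h *s d)) = (*) (D d)"
    using D(1) by (auto simp: clinear_iff mult.commute)
  ultimately show "\<exists>f'. ((\<lambda>x. f (g x)) has_field_derivative f') (at z)"
    unfolding has_field_derivative_def by auto
qed

section \<open>Lipschitz and strict differentiability estimates\<close>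

text \<open>Restricting \<open>f\<close> to the complex line through \<open>x\<close> and
  \<open>y\<close> reduces the claim to one variable: Cauchy's inequality bounds the derivative of
  the restriction along the segment from \<open>y\<close> to \<open>x\<close>, and the mean value
  inequality concludes.\<close>

lemma holomorphic_fun_on_lipschitz:
  assumes f: "holomorphic_fun_on f (ball 0 \<delta>)" and C: "\<And>x. x \<in> ball 0 \<delta> \<Longrightarrow> cmod (f x) \<le> C"
    and "\<delta> > 0" and x: "x \<in> ball 0 (\<delta>/2)" and y: "y \<in> ball 0 (\<delta>/2)"
  shows "cmod (f x - f y) \<le> 4 * C / \<delta> * norm (x - y)"
proof (cases "x = y")
  case False
  define h where "h = x - y"
  have h: "norm h > 0" using False by (simp add: h_def)
  define k where "k = (\<lambda>z. f (y + z *s h))"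
  define T where "T = (\<lambda>z. y + z *s h) -` ball 0 \<delta>"
  have lin: "has_curve_derivative (\<lambda>z. y + z *s h) h z" for z
    unfolding has_curve_derivative_def by (auto intro!: derivative_eq_intros)
  then have der: "((\<lambda>z. y + z *s h) has_derivative (\<lambda>c. c *s h)) (at z)" for z
    by (simp add: has_curve_derivative_iff)
  then have "continuous_on UNIV (\<lambda>z. y + z *s h)"
    by (meson continuous_at_imp_continuous_on has_derivative_continuous)
  then have T: "open T"
    unfolding T_def by (simp add: open_vimage)
  have hol: "k holomorphic_on T"
    unfolding k_def
    by (rule holomorphic_on_compose_curve[OF f T]) (auto simp: T_def intro!: holomorphic_intros)
  \<comment> \<open>Changing the parameter by \<open>R\<close> moves the point by
    \<open>\<delta>/4\<close>. The segment lies in the ball of radius \<open>\<delta>/2\<close>, so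
    the discs of radius \<open>R\<close> about its parameters stay inside the ball of radius
    \<open>\<delta>\<close>.\<close>
  define R where "R = \<delta> / (4 * norm h)"
  have R: "R > 0" using h \<open>\<delta> > 0\<close> by (simp add: R_def)
  have conv: "y + t *s h \<in> ball 0 (\<delta>/2)" if "t \<in> closed_segment 0 1" for t
  proof -
    from that obtain u where u: "0 \<le> u" "u \<le> 1" "t = complex_of_real u"
      by (auto simp: closed_segment_def scaleR_conv_of_real)
    have "y + t *s h = (1 - u) *\<^sub>R y + u *\<^sub>R x"
      by (simp add: vec_eq_iff u(3) h_def scaleR_conv_of_real[where 'a=complex] algebra_simps)
    then show ?thesis
      using convexD_alt[OF convex_ball y x u(1,2)] by simp
  qed
  have cb: "cball t R \<subseteq> T" if "t \<in> closed_segment 0 1" for t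
  proof
    fix z assume "z \<in> cball t R"
    then have "cmod (z - t) * norm h \<le> \<delta>/4"
      using h by (simp add: R_def dist_norm norm_minus_commute field_simps)
    moreover have "y + z *s h = (y + t *s h) + (z - t) *s h"
      by (simp add: vec_eq_iff algebra_simps)
    then have "norm (y + z *s h) \<le> norm (y + t *s h) + cmod (z - t) * norm h"
      by (metis norm_triangle_ineq norm_vector_smult_complex)
    ultimately have "norm (y + z *s h) < \<delta>"
      using conv[OF that] \<open>\<delta> > 0\<close> by simp
    then show "z \<in> T" by (simp add: T_def)
  qed
  have "cmod (k 1 - k 0) \<le> (C / R) * cmod (1 - 0)"
  proof (rule field_differentiable_bound[of "closed_segment 0 1"])
    fix t :: complex assume t: "t \<in> closed_segment 0 1"
    then have tT: "t \<in> T" using cb[OF t] R by auto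
    show "(k has_field_derivative deriv k t) (at t within closed_segment 0 1)"
      by (rule has_field_derivative_at_within[OF holomorphic_derivI[OF hol T tT]])
    have "cmod ((deriv ^^ 1) k t) \<le> fact 1 * C / R ^ 1"
    proof (rule Cauchy_inequality)
      show "k holomorphic_on ball t R"
        using holomorphic_on_subset[OF hol] cb[OF t] ball_subset_cball by blast
      show "continuous_on (cball t R) k"
        using holomorphic_on_imp_continuous_on[OF hol] cb[OF t] continuous_on_subset by blast
      fix z assume "cmod (t - z) = R"
      then have "z \<in> T" using cb[OF t] by (auto simp: dist_norm)
      then show "cmod (k z) \<le> C" using C by (simp add: k_def T_def)
    qed (use R in auto)
    then show "cmod (deriv k t) \<le> C / R" by simp
  qed auto
  then show ?thesis by (simp add: k_def h_def R_def field_simps)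
qed simp

lemma norm_vec_le_sum: "norm (x :: complex ^ 'n) \<le> (\<Sum>i\<in>UNIV. cmod (x $ i))"
  by (simp add: norm_vec_def L2_set_le_sum)

lemma bounded_linear_matrix_vector_mult:
  "bounded_linear ((*v) (A :: complex ^ 'n ^ 'm))"
proof (rule linear_conv_bounded_linear[THEN iffD1], rule linearI)
  show "A *v (x + y) = A *v x + A *v y" for x y by (rule matrix_vector_right_distrib)
  show "A *v (c *\<^sub>R x) = c *\<^sub>R (A *v x)" for c x
    by (simp add: vec_eq_iff matrix_vector_mult_def scaleR_sum_right)
qed

lemma clinear_matrix_row: "Vector_Spaces.linear (*s) (*) (\<lambda>x. (A *v (x :: complex ^ 'n)) $ i)"
  unfolding clinear_iff
  by (simp add: matrix_vector_right_distrib vector_scalar_commute)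

text \<open>The matrix entries are derivatives along the axes, that is, the values
  \<open>D (axis j 1)\<close>; complex linearity recovers all of \<open>D\<close> from them.\<close>

lemma has_derivative_jacobian_matrix:
  assumes "holomorphic_map_on F S" "a \<in> S"
  shows "(F has_derivative (*v) (jacobian_matrix F a)) (at a)"
proof (rule has_derivative_vec_componentwise)
  fix i
  obtain D where D: "Vector_Spaces.linear (*s) (*) D" "((\<lambda>x. F x $ i) has_derivative D) (at a)"
    using assms unfolding holomorphic_map_on_def holomorphic_fun_on_def by blast
  have entry: "jacobian_matrix F a $ i $ j = D (axis j 1)" for j
  proof -
    have "has_curve_derivative (\<lambda>z. a + axis j z) (axis j 1) 0"
      unfolding has_curve_derivative_def axis_def by (auto intro!: derivative_eq_intros)
    then have "((\<lambda>z. a + axis j z) has_derivative (\<lambda>h. h *s axis j 1)) (at 0)"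
      by (simp add: has_curve_derivative_iff)
    from has_derivative_compose[OF this, of "\<lambda>x. F x $ i" D]
    have "((\<lambda>z. F (a + axis j z) $ i) has_derivative (\<lambda>h. D (h *s axis j 1))) (at 0)"
      using D(2) by (simp add: axis_def zero_vec_def[symmetric])
    moreover have "(\<lambda>h. D (h *s axis j 1)) = (*) (D (axis j 1))"
      using D(1) by (auto simp: clinear_iff mult.commute)
    ultimately show ?thesis
      by (simp add: jacobian_matrix_def has_field_derivative_def DERIV_imp_deriv)
  qed
  have "D x = (jacobian_matrix F a *v x) $ i" for x
  proof -
    interpret D: Vector_Spaces.linear "(*s)" "(*)" D by (rule D(1))
    have "D x = D (\<Sum>j\<in>UNIV. (x $ j) *s axis j 1)" by (simp add: basis_expansion)
    also have "\<dots> = (\<Sum>j\<in>UNIV. x $ j * D (axis j 1))" by (simp add: D.sum D.scale)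
    also have "\<dots> = (jacobian_matrix F a *v x) $ i"
      by (simp add: matrix_vector_mult_def entry mult.commute)
    finally show ?thesis .
  qed
  then have "D = (\<lambda>x. (jacobian_matrix F a *v x) $ i)" by auto
  with D(2) show "((\<lambda>x. F x $ i) has_derivative (\<lambda>x. (jacobian_matrix F a *v x) $ i)) (at a)"
    by simp
qed

text \<open>The nonlinear part \<open>G\<close> of \<open>F\<close> at \<open>0\<close> is
  \<open>o(norm x)\<close>, so on a ball of radius \<open>\<delta>\<close> it is at most a small
  multiple of \<open>\<delta>\<close>. The Cauchy-type Lipschitz estimate divides by
  \<open>\<delta>\<close>, which leaves a small Lipschitz constant on the ball of half the
  radius.\<close>

lemma holomorphic_map_strict_derivative:
  fixes F :: "complex ^ 'n \<Rightarrow> complex ^ 'n"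
  assumes hol: "holomorphic_map_on F (ball 0 r)" and "r > 0" "e > 0"
  obtains \<delta> where "0 < \<delta>" "\<delta> \<le> r"
    "\<And>x y. x \<in> ball 0 \<delta> \<Longrightarrow> y \<in> ball 0 \<delta> \<Longrightarrow>
       norm (F x - F y - jacobian_matrix F 0 *v (x - y)) \<le> e * norm (x - y)"
proof -
  define A where "A = jacobian_matrix F 0"
  define N where "N = real CARD('n)"
  have N: "N > 0" by (simp add: N_def)
  have "(F has_derivative (*v) A) (at 0)"
    unfolding A_def using has_derivative_jacobian_matrix[OF hol] \<open>r > 0\<close> by simp
  \<comment> \<open>The \<open>4\<close> absorbs the factor in
    \<open>holomorphic_fun_on_lipschitz\<close>; the \<open>N\<close> absorbs the sum over the
    coordinates at the end.\<close>
  moreover have "e / (4 * N) > 0" using N \<open>e > 0\<close> by simp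
  ultimately obtain d where d: "d > 0"
    "\<And>y. norm y < d \<Longrightarrow> norm (F y - F 0 - A *v y) \<le> e / (4 * N) * norm y"
    unfolding has_derivative_at_alt by (metis diff_zero)
  define \<delta> where "\<delta> = min d r"
  have \<delta>: "\<delta> > 0" "\<delta> \<le> d" "\<delta> \<le> r" using d(1) \<open>r > 0\<close> by (auto simp: \<delta>_def)
  define G where "G = (\<lambda>x. F x - F 0 - A *v x)"
  have G: "cmod (G x $ i - G y $ i) \<le> e / N * norm (x - y)"
    if xy: "x \<in> ball 0 (\<delta>/2)" "y \<in> ball 0 (\<delta>/2)" for x y i
  proof -
    have "holomorphic_fun_on (\<lambda>x. G x $ i) (ball 0 \<delta>)"
      unfolding holomorphic_fun_on_def
    proof
      fix x :: "complex ^ 'n" assume "x \<in> ball 0 \<delta>"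
      then have "x \<in> ball 0 r" using \<delta> by simp
      then obtain D where D: "Vector_Spaces.linear (*s) (*) D" "((\<lambda>x. F x $ i) has_derivative D) (at x)"
        using hol unfolding holomorphic_map_on_def holomorphic_fun_on_def by blast
      have "((\<lambda>x. G x $ i) has_derivative (\<lambda>h. D h - (A *v h) $ i)) (at x)"
        unfolding G_def vector_minus_component
        by (auto intro!: derivative_eq_intros D(2) bounded_linear.has_derivative[OF bounded_linear_vec_nth]
            bounded_linear.has_derivative[OF bounded_linear_matrix_vector_mult])
      moreover have "Vector_Spaces.linear (*s) (*) (\<lambda>h. D h - (A *v h) $ i)"
        using D(1) clinear_matrix_row[of A i] by (auto simp: clinear_iff algebra_simps)
      ultimately show "\<exists>D. Vector_Spaces.linear (*s) (*) D \<and> ((\<lambda>x. G x $ i) has_derivative D) (at x)"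
        by blast
    qed
    moreover have "cmod (G x $ i) \<le> e / (4 * N) * \<delta>" if "x \<in> ball 0 \<delta>" for x
    proof -
      have "cmod (G x $ i) \<le> norm (G x)" by (rule Finite_Cartesian_Product.norm_nth_le)
      also have "\<dots> \<le> e / (4 * N) * norm x" using d(2)[of x] that \<delta> by (simp add: G_def)
      also have "\<dots> \<le> e / (4 * N) * \<delta>" using that \<open>e > 0\<close> N by (intro mult_left_mono) auto
      finally show ?thesis .
    qed
    ultimately have "cmod (G x $ i - G y $ i) \<le> 4 * (e / (4 * N) * \<delta>) / \<delta> * norm (x - y)"
      using holomorphic_fun_on_lipschitz[of "\<lambda>x. G x $ i" \<delta>] \<delta>(1) xy by blast
    then show ?thesis using \<delta>(1) by simp
  qed
  show thesis
  proof
    show "0 < \<delta>/2" "\<delta>/2 \<le> r" using \<delta> by auto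
    fix x y :: "complex ^ 'n" assume xy: "x \<in> ball 0 (\<delta>/2)" "y \<in> ball 0 (\<delta>/2)"
    have "norm (G x - G y) \<le> (\<Sum>i\<in>UNIV. cmod ((G x - G y) $ i))" by (rule norm_vec_le_sum)
    also have "\<dots> \<le> (\<Sum>i\<in>(UNIV :: 'n set). e / N * norm (x - y))"
      using G[OF xy] by (intro sum_mono) simp
    also have "\<dots> = e * norm (x - y)" using N by (simp add: N_def)
    finally show "norm (F x - F y - jacobian_matrix F 0 *v (x - y)) \<le> e * norm (x - y)"
      by (simp add: G_def A_def[symmetric] algebra_simps)
  qed
qed

lemma holomorphic_map_locally_lipschitz:
  fixes F :: "complex ^ 'n \<Rightarrow> complex ^ 'n"
  assumes hol: "holomorphic_map_on F (ball 0 r)" and "r > 0"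
  obtains \<delta> L where "0 < \<delta>" "\<delta> \<le> r" "0 < L"
    "\<And>x y. x \<in> ball 0 \<delta> \<Longrightarrow> y \<in> ball 0 \<delta> \<Longrightarrow> norm (F x - F y) \<le> L * norm (x - y)"
proof -
  define A where "A = jacobian_matrix F 0"
  obtain K where K: "K > 0" "\<And>x. norm (A *v x) \<le> norm x * K"
    using bounded_linear.pos_bounded[OF bounded_linear_matrix_vector_mult[of A]] by blast
  obtain \<delta> where \<delta>: "0 < \<delta>" "\<delta> \<le> r"
    "\<And>x y. x \<in> ball 0 \<delta> \<Longrightarrow> y \<in> ball 0 \<delta> \<Longrightarrow> norm (F x - F y - A *v (x - y)) \<le> 1 * norm (x - y)"
    unfolding A_def using holomorphic_map_strict_derivative[OF assms zero_less_one] by blast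
  show thesis
  proof
    fix x y :: "complex ^ 'n" assume "x \<in> ball 0 \<delta>" "y \<in> ball 0 \<delta>"
    from \<delta>(3)[OF this] K(2)[of "x - y"] norm_triangle_ineq[of "F x - F y - A *v (x - y)" "A *v (x - y)"]
    show "norm (F x - F y) \<le> (1 + K) * norm (x - y)" by (simp add: algebra_simps)
  qed (use \<delta> K in auto)
qed

subsection \<open>The invariant curve\<close>

text \<open>The quotient \<open>f z / z ^ m\<close>, extended by its limit \<open>0\<close>, has a
  removable singularity at the origin. The extension vanishes there, so one further factor
  \<open>z\<close> splits off.\<close>

lemma holomorphic_factor_zero_order:
  fixes f :: "complex \<Rightarrow> complex"
  assumes hol: "f holomorphic_on ball 0 \<rho>" and "\<rho> > 0" and lim: "((\<lambda>z. f z / z ^ m) \<longlongrightarrow> 0) (at 0)"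
  obtains h where "h holomorphic_on ball 0 \<rho>" "\<And>z. z \<in> ball 0 \<rho> \<Longrightarrow> f z = z ^ Suc m * h z"
proof -
  define k where "k = (\<lambda>z. if z = 0 then 0 else f z / z ^ m)"
  have "((\<lambda>z. f z / z ^ m * z ^ m) \<longlongrightarrow> 0 * 0 ^ m) (at 0)"
    by (intro tendsto_intros lim)
  moreover have "\<forall>\<^sub>F z in at 0. f z / z ^ m * z ^ m = f z"
    by (simp add: eventually_at_filter)
  ultimately have "(f \<longlongrightarrow> 0) (at 0)"
    using tendsto_cong[of "\<lambda>z. f z / z ^ m * z ^ m" f "at 0"] by simp
  moreover have "isCont f 0"
    using holomorphic_on_imp_continuous_on[OF hol] \<open>\<rho> > 0\<close>
    by (simp add: continuous_on_eq_continuous_at)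
  ultimately have f0: "f 0 = 0"
    using LIM_unique isCont_def by blast
  have kf: "f z = z ^ m * k z" for z using f0 by (simp add: k_def)
  have 1: "k holomorphic_on (ball 0 \<rho> - {0})"
  proof -
    have "(\<lambda>z. f z / z ^ m) holomorphic_on (ball 0 \<rho> - {0})"
      by (intro holomorphic_intros holomorphic_on_subset[OF hol]) auto
    then show ?thesis by (rule holomorphic_transform) (auto simp: k_def)
  qed
  have "\<forall>\<^sub>F z in at 0. k z = f z / z ^ m"
    by (simp add: eventually_at_filter k_def)
  then have "isCont k 0"
    unfolding isCont_def using lim tendsto_cong[of k "\<lambda>z. f z / z ^ m" "at 0"] by (simp add: k_def)
  moreover have "continuous_on (ball 0 \<rho> - {0}) k"
    using 1 by (rule holomorphic_on_imp_continuous_on)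
  ultimately have "continuous_on (ball 0 \<rho>) k"
    by (auto simp: continuous_on_eq_continuous_at open_Diff)
  then have k: "k holomorphic_on ball 0 \<rho>"
    by (rule no_isolated_singularity[OF _ 1]) auto
  show thesis
  proof
    show "(\<lambda>z. if z = 0 then deriv k 0 else (k z - k 0) / (z - 0)) holomorphic_on ball 0 \<rho>"
      by (rule pole_lemma[OF k]) (use \<open>\<rho> > 0\<close> in simp)
    show "f z = z ^ Suc m * (if z = 0 then deriv k 0 else (k z - k 0) / (z - 0))" for z
      by (cases "z = 0") (simp_all add: f0 k_def)
  qed
qed

lemma has_curve_derivative_isCont: "has_curve_derivative p d z \<Longrightarrow> isCont p z"
  using has_curve_derivative_iff has_derivative_continuous by blast

lemma has_curve_derivative_holomorphic:
  assumes "open S" "\<And>z. z \<in> S \<Longrightarrow> has_curve_derivative p (p' z) z"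
  shows "(\<lambda>z. p z $ i) holomorphic_on S" "(\<lambda>z. p' z $ i) holomorphic_on S"
proof -
  have d: "((\<lambda>z. p z $ i) has_field_derivative p' z $ i) (at z)" if "z \<in> S" for z
    using assms(2)[OF that] by (simp add: has_curve_derivative_def)
  then show hol: "(\<lambda>z. p z $ i) holomorphic_on S"
    using \<open>open S\<close> by (auto simp: holomorphic_on_open)
  show "(\<lambda>z. p' z $ i) holomorphic_on S"
    by (rule holomorphic_transform[OF holomorphic_deriv[OF hol \<open>open S\<close>]])
      (use d in \<open>simp add: DERIV_imp_deriv\<close>)
qed

text \<open>Holomorphy improves a residual that is \<open>o(z\<^sup>m)\<close> to one divisible by \<open>z\<^sup>m\<^sup>+\<^sup>1\<close>.\<close>

lemma residual_factor:
  fixes F :: "complex ^ 'n \<Rightarrow> complex ^ 'n"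
  assumes hol: "holomorphic_map_on F (ball 0 r)" and "r > 0"
    and p: "\<And>z. has_curve_derivative p (p' z) z" "p 0 = 0"
    and small: "\<And>e. e > 0 \<Longrightarrow>
       \<forall>\<^sub>F z in at 0. norm (F (p z) - (\<kappa> * z) *s p' z) \<le> e * cmod z ^ m"
  shows "\<exists>\<rho>>0. \<exists>h. (\<forall>i. (\<lambda>z. h z $ i) holomorphic_on ball 0 \<rho>) \<and>
     (\<forall>z\<in>ball 0 \<rho>. F (p z) - (\<kappa> * z) *s p' z = z ^ Suc m *s h z)"
proof -
  have "isCont p 0" using p(1) by (rule has_curve_derivative_isCont)
  then obtain \<rho> where \<rho>: "\<rho> > 0" "\<And>z. z \<in> ball 0 \<rho> \<Longrightarrow> p z \<in> ball 0 r"
    using \<open>r > 0\<close> p(2) unfolding continuous_at_eps_delta by (auto simp: dist_norm)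
  define R where "R = (\<lambda>z. F (p z) - (\<kappa> * z) *s p' z)"
  note pi = has_curve_derivative_holomorphic(1)[OF open_UNIV p(1)]
    and p'i = has_curve_derivative_holomorphic(2)[OF open_UNIV p(1)]
  have "\<exists>h. h holomorphic_on ball 0 \<rho> \<and> (\<forall>z\<in>ball 0 \<rho>. R z $ i = z ^ Suc m * h z)" for i
  proof -
    have "(\<lambda>z. F (p z) $ i) holomorphic_on ball 0 \<rho>"
    proof (rule holomorphic_on_compose_curve[of "\<lambda>x. F x $ i" "ball 0 r" _ p])
      show "holomorphic_fun_on (\<lambda>x. F x $ i) (ball 0 r)"
        using hol by (simp add: holomorphic_map_on_def)
      show "(\<lambda>z. p z $ j) holomorphic_on ball 0 \<rho>" for j
        using pi by (rule holomorphic_on_subset) simp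
    qed (use \<rho>(2) in auto)
    then have Ri: "(\<lambda>z. R z $ i) holomorphic_on ball 0 \<rho>"
      unfolding R_def vector_minus_component vector_smult_component
      by (intro holomorphic_intros holomorphic_on_subset[OF p'i]) auto
    have "((\<lambda>z. R z $ i / z ^ m) \<longlongrightarrow> 0) (at 0)"
    proof (rule tendstoI)
      fix e :: real assume "e > 0"
      then have "\<forall>\<^sub>F z in at 0. norm (R z) \<le> (e/2) * cmod z ^ m"
        using small[of "e/2"] by (simp add: R_def)
      moreover have "\<forall>\<^sub>F z in at (0::complex). z \<noteq> 0" by (simp add: eventually_at_filter)
      ultimately show "\<forall>\<^sub>F z in at 0. dist (R z $ i / z ^ m) 0 < e"
      proof eventually_elim
        case (elim z)
        have "cmod (R z $ i) \<le> (e/2) * cmod z ^ m"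
          using elim(1) Finite_Cartesian_Product.norm_nth_le[of "R z" i] by linarith
        then have "cmod (R z $ i / z ^ m) \<le> e/2"
          using elim(2) by (simp add: norm_divide norm_power divide_le_eq)
        then show ?case using \<open>e > 0\<close> by simp
      qed
    qed
    then show ?thesis
      by (rule holomorphic_factor_zero_order[OF Ri \<rho>(1)]) blast
  qed
  then have "\<exists>h. \<forall>i. h i holomorphic_on ball 0 \<rho> \<and> (\<forall>z\<in>ball 0 \<rho>. R z $ i = z ^ Suc m * h i z)"
    by (intro choice) blast
  then obtain h where h: "\<And>i. h i holomorphic_on ball 0 \<rho>"
    "\<And>i z. z \<in> ball 0 \<rho> \<Longrightarrow> R z $ i = z ^ Suc m * h i z"
    by blast
  have "R z = z ^ Suc m *s (\<chi> i. h i z)" if "z \<in> ball 0 \<rho>" for z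
    using h(2)[OF that] by (simp add: vec_eq_iff)
  then show ?thesis
    unfolding R_def using \<rho> h(1)
    by (intro exI[of _ \<rho>] conjI exI[of _ "\<lambda>z. \<chi> i. h i z"]) auto
qed

section \<open>Formal solution to arbitrary order\<close>

text \<open>An injective square matrix is surjective. This solves the linear equation for a single
  Taylor coefficient of the curve at a nonresonant order.\<close>

lemma matrix_not_eigenvalue_solvable:
  assumes "\<not> matrix_eigenvalue A l"
  shows "\<exists>q. A *v q - l *s q = b"
proof -
  define B where "B = A - mat l"
  have B: "B *v x = A *v x - l *s x" for x
    by (simp add: B_def matrix_vector_mult_diff_rdistrib vec_eq_iff matrix_vector_mult_def mat_def
        left_diff_distrib sum_subtractf if_distribR if_distrib[of "\<lambda>c. c * _"] cong: if_cong)
  have "\<forall>x. B *v x = 0 \<longrightarrow> x = 0"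
    using assms by (auto simp: B matrix_eigenvalue_def)
  then have "\<exists>C. C ** B = mat 1" by (simp add: matrix_left_invertible_ker)
  then have "\<exists>C. B ** C = mat 1" using matrix_left_right_inverse by blast
  then have "surj ((*v) B)" by (simp add: matrix_right_invertible_surjective)
  then show ?thesis unfolding B[symmetric] by (metis surjD)
qed

text \<open>Induction on the order. The line \<open>z *s v\<close> has residual \<open>o(z)\<close>
  because \<open>v\<close> is an eigenvector. Adding \<open>z ^ Suc m *s q\<close> changes the
  leading coefficient of the residual by \<open>A *v q - (of_nat (Suc m) * \<kappa>) *s q\<close>,
  and \<open>q\<close> is chosen to cancel \<open>h 0\<close>. Each time
  \<open>residual_factor\<close> turns the small-o estimate into divisibility by the next
  power.\<close>

lemma formal_solution:
  fixes F :: "complex ^ 'n \<Rightarrow> complex ^ 'n"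
  defines "A \<equiv> jacobian_matrix F 0"
  assumes hol: "holomorphic_map_on F (ball 0 r)" and "r > 0" and F0: "F 0 = 0"
    and v: "A *v v = \<kappa> *s v"
    and nonres: "\<And>k. k \<ge> 2 \<Longrightarrow> \<not> matrix_eigenvalue A (of_nat k * \<kappa>)"
    and "m \<ge> 1"
  shows "\<exists>p p'. (\<forall>z. has_curve_derivative p (p' z) z) \<and> p 0 = 0 \<and> p' 0 = v \<and>
    (\<exists>\<rho>>0. \<exists>h. (\<forall>i. (\<lambda>z. h z $ i) holomorphic_on ball 0 \<rho>) \<and>
     (\<forall>z\<in>ball 0 \<rho>. F (p z) - (\<kappa> * z) *s p' z = z ^ Suc m *s h z))"
  using \<open>m \<ge> 1\<close>
proof (induction m rule: nat_induct_at_least)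
  case base
  define p where "p = (\<lambda>z :: complex. z *s v)"
  have p: "has_curve_derivative p v z" for z
    unfolding has_curve_derivative_def p_def by (auto intro!: derivative_eq_intros)
  have small: "\<forall>\<^sub>F z in at 0. norm (F (p z) - (\<kappa> * z) *s v) \<le> e * cmod z ^ 1" if "e > 0" for e
  proof -
    define e' where "e' = e / (1 + norm v)"
    have e': "e' > 0" using \<open>e > 0\<close> by (simp add: e'_def add_pos_nonneg)
    have "e' * norm v \<le> e" using \<open>e > 0\<close>
      by (simp add: e'_def divide_le_eq add_pos_nonneg algebra_simps)
    obtain \<delta> where \<delta>: "0 < \<delta>" "\<delta> \<le> r"
      "\<And>x y. x \<in> ball 0 \<delta> \<Longrightarrow> y \<in> ball 0 \<delta> \<Longrightarrow> norm (F x - F y - A *v (x - y)) \<le> e' * norm (x - y)"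
      unfolding A_def using holomorphic_map_strict_derivative[OF hol \<open>r > 0\<close> e'] by blast
    have "(p \<longlongrightarrow> p 0) (at 0)" using has_curve_derivative_isCont[OF p] isCont_def by blast
    then have "\<forall>\<^sub>F z in at 0. dist (p z) (p 0) < \<delta>" using \<delta>(1) by (rule tendstoD)
    then show ?thesis
    proof eventually_elim
      case (elim z)
      then have "p z \<in> ball 0 \<delta>" by (simp add: p_def)
      from \<delta>(3)[OF this, of 0] have "norm (F (p z) - A *v p z) \<le> e' * (cmod z * norm v)"
        using \<delta>(1) F0 by (simp add: p_def norm_vector_smult_complex)
      also have "\<dots> \<le> e * cmod z"
        using mult_right_mono[OF \<open>e' * norm v \<le> e\<close>, of "cmod z"] by (simp add: mult_ac)
      also have "A *v p z = (\<kappa> * z) *s v"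
        by (simp add: p_def vector_scalar_commute v mult.commute)
      finally show ?case by simp
    qed
  qed
  have "p 0 = 0" by (simp add: p_def)
  from residual_factor[OF hol \<open>r > 0\<close> p this small]
  show ?case using p \<open>p 0 = 0\<close> by (intro exI[of _ p] exI[of _ "\<lambda>_. v"]) auto
next
  case (Suc m)
  then obtain p p' \<rho> h where p: "\<And>z. has_curve_derivative p (p' z) z" "p 0 = 0" "p' 0 = v"
    and \<rho>: "\<rho> > 0" and h: "\<And>i. (\<lambda>z. h z $ i) holomorphic_on ball 0 \<rho>"
    and R: "\<And>z. z \<in> ball 0 \<rho> \<Longrightarrow> F (p z) - (\<kappa> * z) *s p' z = z ^ Suc m *s h z"
    by blast
  \<comment> \<open>The correction has degree \<open>Suc m\<close>, which is at least 2, so the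
    eigenvalue \<open>\<kappa>\<close> itself is never the obstruction.\<close>
  have "\<not> matrix_eigenvalue A (of_nat (Suc m) * \<kappa>)" using \<open>1 \<le> m\<close> by (intro nonres) simp
  then obtain q where q: "A *v q - (of_nat (Suc m) * \<kappa>) *s q = - h 0"
    using matrix_not_eigenvalue_solvable by blast
  define P where "P = (\<lambda>z. p z + z ^ Suc m *s q)"
  define P' where "P' = (\<lambda>z. p' z + (of_nat (Suc m) * z ^ m) *s q)"
  have P: "has_curve_derivative P (P' z) z" for z
    using p(1) unfolding has_curve_derivative_def P_def P'_def
    by (auto intro!: derivative_eq_intros simp del: power_Suc)
  have P0: "P 0 = 0" "P' 0 = v" using p \<open>1 \<le> m\<close> by (auto simp: P_def P'_def)
  \<comment> \<open>One half of \<open>e\<close> pays for the error in linearising \<open>F\<close>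
    between \<open>p z\<close> and \<open>P z\<close>, the other for the oscillation of
    \<open>h\<close> at \<open>0\<close>.\<close>
  have small: "\<forall>\<^sub>F z in at 0. norm (F (P z) - (\<kappa> * z) *s P' z) \<le> e * cmod z ^ Suc m" if "e > 0" for e
  proof -
    define e' where "e' = e / (2 * (1 + norm q))"
    have e': "e' > 0" using \<open>e > 0\<close> by (simp add: e'_def add_pos_nonneg)
    have e'q: "e' * norm q \<le> e/2" using \<open>e > 0\<close>
      by (simp add: e'_def divide_le_eq add_pos_nonneg algebra_simps)
    obtain \<delta> where \<delta>: "0 < \<delta>" "\<delta> \<le> r"
      "\<And>x y. x \<in> ball 0 \<delta> \<Longrightarrow> y \<in> ball 0 \<delta> \<Longrightarrow> norm (F x - F y - A *v (x - y)) \<le> e' * norm (x - y)"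
      unfolding A_def using holomorphic_map_strict_derivative[OF hol \<open>r > 0\<close> e'] by blast
    have "(p \<longlongrightarrow> p 0) (at 0)" "(P \<longlongrightarrow> P 0) (at 0)"
      using has_curve_derivative_isCont[OF p(1)] has_curve_derivative_isCont[OF P] isCont_def by blast+
    then have "\<forall>\<^sub>F z in at 0. dist (p z) (p 0) < \<delta>" "\<forall>\<^sub>F z in at 0. dist (P z) (P 0) < \<delta>"
      using \<delta>(1) by (auto dest: tendstoD)
    moreover have "(h \<longlongrightarrow> h 0) (at 0)"
    proof (rule vec_tendstoI)
      fix i
      have "isCont (\<lambda>z. h z $ i) 0"
        using holomorphic_on_imp_continuous_on[OF h] \<rho> by (simp add: continuous_on_eq_continuous_at)
      then show "((\<lambda>z. h z $ i) \<longlongrightarrow> h 0 $ i) (at 0)" by (simp add: isCont_def)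
    qed
    then have "\<forall>\<^sub>F z in at 0. dist (h z) (h 0) < e/2" using \<open>e > 0\<close> by (intro tendstoD) auto
    moreover have "\<forall>\<^sub>F z in at 0. z \<in> ball 0 \<rho>"
      using \<rho> by (intro eventually_at_in_open') auto
    ultimately show ?thesis
    proof eventually_elim
      case (elim z)
      define w where "w = z ^ Suc m"
      have Pp: "P z - p z = w *s q" by (simp add: P_def w_def)
      have Aq: "A *v q = (of_nat (Suc m) * \<kappa>) *s q - h 0" using q by (simp add: algebra_simps)
      have "F (P z) - (\<kappa> * z) *s P' z =
        (F (P z) - F (p z) - A *v (P z - p z)) + A *v (w *s q)
          + (F (p z) - (\<kappa> * z) *s p' z) - (of_nat (Suc m) * \<kappa> * w) *s q"
        unfolding Pp by (simp add: P'_def w_def vec_eq_iff algebra_simps)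
      \<comment> \<open>By the choice of \<open>q\<close>, the linear terms in \<open>q\<close> add
        up to \<open>- w *s h 0\<close>, which meets the old residual
        \<open>w *s h z\<close>.\<close>
      also have "\<dots> = (F (P z) - F (p z) - A *v (P z - p z)) + w *s (h z - h 0)"
        unfolding R[OF elim(4)] vector_scalar_commute Aq w_def[symmetric]
        by (simp add: vec_eq_iff algebra_simps)
      finally have "norm (F (P z) - (\<kappa> * z) *s P' z)
          \<le> norm (F (P z) - F (p z) - A *v (P z - p z)) + norm (w *s (h z - h 0))"
        by (simp only: norm_triangle_ineq)
      also have "norm (F (P z) - F (p z) - A *v (P z - p z)) \<le> e' * norm (P z - p z)"
        using elim(1,2) P0 p(2) by (intro \<delta>(3)) auto
      also have "e' * norm (P z - p z) = e' * norm q * cmod w"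
        unfolding Pp by (simp add: norm_vector_smult_complex)
      also have "\<dots> \<le> e/2 * cmod w" using e'q by (intro mult_right_mono) auto
      also have "norm (w *s (h z - h 0)) = norm (h z - h 0) * cmod w"
        by (metis norm_vector_smult_complex mult.commute)
      also have "\<dots> \<le> e/2 * cmod w" using elim(3) by (intro mult_right_mono) (auto simp: dist_norm)
      finally show ?case by (simp add: w_def norm_power norm_mult)
    qed
  qed
  from residual_factor[OF hol \<open>r > 0\<close> P P0(1) small]
  show ?case using P P0 by (intro exI[of _ P] exI[of _ P']) auto
qed

section \<open>Inverting the Euler operator\<close>

text \<open>Along the radius \<open>t \<mapsto> t z\<close> the derivative of \<open>w\<close> is at
  most a constant times \<open>t ^ (m - 1)\<close>, and integration over \<open>[0, 1]\<close>
  produces the gain \<open>1 / m\<close> on which the contraction relies.\<close>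

lemma euler_primitive_bound:
  fixes w :: "complex \<Rightarrow> complex ^ 'n"
  assumes w: "\<And>z. z \<in> ball 0 \<rho> \<Longrightarrow> has_curve_derivative w (w' z) z" "w 0 = 0"
    and bound: "\<And>z. z \<in> ball 0 \<rho> \<Longrightarrow> norm ((\<kappa> * z) *s w' z) \<le> C * cmod z ^ m"
    and "\<kappa> \<noteq> 0" "m \<ge> 1" and z: "z \<in> ball 0 \<rho>"
  shows "norm (w z) \<le> C / (real m * cmod \<kappa>) * cmod z ^ m"
proof (cases "z = 0")
  case True
  then show ?thesis using w(2) \<open>m \<ge> 1\<close> by (simp add: power_0_left)
next
  case False
  define \<phi> where "\<phi> = (\<lambda>t::real. w (of_real t * z))"
  \<comment> \<open>The primitive of the bound on the derivative of \<open>\<phi>\<close>; the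
    general mean value inequality compares the two increments.\<close>
  define \<psi> where "\<psi> = (\<lambda>t::real. C * cmod z ^ m / (real m * cmod \<kappa>) * t ^ m)"
  have tz: "of_real t * z \<in> ball 0 \<rho>" if "t \<in> {0..1}" for t :: real
  proof -
    have "\<bar>t\<bar> * cmod z \<le> 1 * cmod z" using that by (intro mult_right_mono) auto
    then show ?thesis using z by (simp add: norm_mult)
  qed
  have der: "(\<phi> has_vector_derivative z *s w' (of_real t * z)) (at t)" if "t \<in> {0..1}" for t
  proof -
    have "((\<lambda>t. of_real t * z) has_derivative (\<lambda>h::real. of_real h * z)) (at t)"
      by (intro bounded_linear_imp_has_derivative bounded_linear_mult_const bounded_linear_of_real)
    moreover have "(w has_derivative (\<lambda>h. h *s w' (of_real t * z))) (at (of_real t * z))"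
      using w(1)[OF tz[OF that]] by (simp add: has_curve_derivative_iff)
    ultimately have "(\<phi> has_derivative (\<lambda>h. (of_real h * z) *s w' (of_real t * z))) (at t)"
      unfolding \<phi>_def by (rule has_derivative_compose)
    moreover have "(of_real h * z) *s w' (of_real t * z) = h *\<^sub>R (z *s w' (of_real t * z))" for h
      by (simp add: vec_eq_iff scaleR_conv_of_real[where 'a=complex])
    ultimately show ?thesis by (simp add: has_vector_derivative_def)
  qed
  have "norm (\<phi> 1 - \<phi> 0) \<le> \<psi> 1 - \<psi> 0"
  proof (rule differentiable_bound_general[of 0 1])
    show "continuous_on {0..1} \<phi>"
      using der by (meson continuous_at_imp_continuous_on has_vector_derivative_continuous)
    show "continuous_on {0..1} \<psi>" unfolding \<psi>_def by (intro continuous_intros)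
    fix t :: real assume t: "0 < t" "t < 1"
    show "(\<phi> has_vector_derivative z *s w' (of_real t * z)) (at t)" using t by (intro der) auto
    show "(\<psi> has_vector_derivative C * cmod z ^ m / cmod \<kappa> * t ^ (m - 1)) (at t)"
      unfolding \<psi>_def has_real_derivative_iff_has_vector_derivative[symmetric]
      using \<open>m \<ge> 1\<close> \<open>\<kappa> \<noteq> 0\<close> by (auto intro!: derivative_eq_intros)
    have "cmod \<kappa> * t * norm (z *s w' (of_real t * z)) = norm ((\<kappa> * (of_real t * z)) *s w' (of_real t * z))"
      using t by (simp add: norm_vector_smult_complex norm_mult)
    also have "\<dots> \<le> C * cmod (of_real t * z) ^ m" using t by (intro bound tz) auto
    also have "\<dots> = C * cmod z ^ m * t ^ (m - 1) * t"
      using t \<open>m \<ge> 1\<close> by (simp add: norm_mult power_mult_distrib flip: power_minus_mult[of m t])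
    finally show "norm (z *s w' (of_real t * z)) \<le> C * cmod z ^ m / cmod \<kappa> * t ^ (m - 1)"
      using t \<open>\<kappa> \<noteq> 0\<close> by (simp add: field_simps)
  qed simp
  then show ?thesis using w(2) \<open>m \<ge> 1\<close> by (simp add: \<phi>_def \<psi>_def power_0_left)
qed

text \<open>As \<open>N\<close> vanishes at \<open>0\<close>, the quotient \<open>N z / z\<close>
  extends holomorphically over the origin. A primitive of it divided by \<open>\<kappa>\<close>,
  normalised at \<open>0\<close>, is the required curve.\<close>

lemma euler_primitive_exists:
  fixes N :: "complex \<Rightarrow> complex ^ 'n"
  assumes N: "\<And>i. (\<lambda>z. N z $ i) holomorphic_on ball 0 \<rho>" "N 0 = 0" and "\<rho> > 0" "\<kappa> \<noteq> 0"
  obtains w w' where "\<And>z. z \<in> ball 0 \<rho> \<Longrightarrow> has_curve_derivative w (w' z) z" "w 0 = 0"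
    "\<And>z. z \<in> ball 0 \<rho> \<Longrightarrow> (\<kappa> * z) *s w' z = N z"
proof -
  have "\<exists>u u'. u 0 = 0 \<and> (\<forall>z\<in>ball 0 \<rho>. (u has_field_derivative u' z) (at z) \<and> \<kappa> * z * u' z = N z $ i)"
    for i
  proof -
    define q where "q = (\<lambda>z. if z = 0 then deriv (\<lambda>z. N z $ i) 0 else (N z $ i - N 0 $ i) / (z - 0))"
    have "q holomorphic_on ball 0 \<rho>"
      unfolding q_def by (rule pole_lemma[OF N(1)]) (use \<open>\<rho> > 0\<close> in simp)
    then have "(\<lambda>z. q z / \<kappa>) holomorphic_on ball 0 \<rho>"
      using \<open>\<kappa> \<noteq> 0\<close> by (intro holomorphic_intros) auto
    then obtain u where u: "\<And>z. z \<in> ball 0 \<rho> \<Longrightarrow> (u has_field_derivative q z / \<kappa>) (at z within ball 0 \<rho>)"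
      by (rule holomorphic_convex_primitive'[OF convex_ball open_ball]) blast
    have "((\<lambda>z. u z - u 0) has_field_derivative q z / \<kappa>) (at z)" if "z \<in> ball 0 \<rho>" for z
      using u[OF that] that by (auto intro!: derivative_eq_intros simp: at_within_open[OF _ open_ball])
    moreover have "\<kappa> * z * (q z / \<kappa>) = N z $ i" for z
      using N(2) \<open>\<kappa> \<noteq> 0\<close> by (simp add: q_def)
    ultimately show ?thesis
      by (intro exI[of _ "\<lambda>z. u z - u 0"] exI[of _ "\<lambda>z. q z / \<kappa>"]) simp
  qed
  then have "\<exists>u. \<forall>i. \<exists>u'. u i 0 = 0 \<and>
      (\<forall>z\<in>ball 0 \<rho>. (u i has_field_derivative u' z) (at z) \<and> \<kappa> * z * u' z = N z $ i)"
    by (intro choice) blast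
  then obtain u where "\<forall>i. \<exists>u'. u i 0 = 0 \<and>
      (\<forall>z\<in>ball 0 \<rho>. (u i has_field_derivative u' z) (at z) \<and> \<kappa> * z * u' z = N z $ i)" ..
  then obtain u' where u: "\<And>i. u i 0 = 0"
    "\<And>i z. z \<in> ball 0 \<rho> \<Longrightarrow> (u i has_field_derivative u' i z) (at z)"
    "\<And>i z. z \<in> ball 0 \<rho> \<Longrightarrow> \<kappa> * z * u' i z = N z $ i"
    using choice[of "\<lambda>i u'. u i 0 = 0 \<and>
      (\<forall>z\<in>ball 0 \<rho>. (u i has_field_derivative u' z) (at z) \<and> \<kappa> * z * u' z = N z $ i)"] by blast
  show thesis
    by (rule that[of "\<lambda>z. \<chi> i. u i z" "\<lambda>z. \<chi> i. u' i z"])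
      (use u in \<open>auto simp: has_curve_derivative_def vec_eq_iff\<close>)
qed

section \<open>Convergence of the remainder iteration\<close>

text \<open>The curve is \<open>g = p + w\<close> with \<open>p\<close> a formal solution of high
  order. The equation for \<open>w\<close> is solved by Picard iteration from \<open>0\<close>: each
  iterate solves the Euler equation with the previous one inserted in \<open>F\<close>. The bound
  \<open>B * cmod z ^ m\<close> is preserved, and the estimate for consecutive differences halves at
  each step.\<close>

lemma convergent_solution:
  fixes F :: "complex ^ 'n \<Rightarrow> complex ^ 'n"
  assumes hol: "holomorphic_map_on F (ball 0 r)" and "r > 0" and F0: "F 0 = 0" and "\<kappa> \<noteq> 0"
    and v: "jacobian_matrix F 0 *v v = \<kappa> *s v"
    and nonres: "\<And>k. k \<ge> 2 \<Longrightarrow> \<not> matrix_eigenvalue (jacobian_matrix F 0) (of_nat k * \<kappa>)"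
  obtains g g' \<rho> where "\<rho> > 0" "g 0 = 0" "g' 0 = v"
    "\<And>z. z \<in> ball 0 \<rho> \<Longrightarrow> g z \<in> ball 0 r"
    "\<And>z. z \<in> ball 0 \<rho> \<Longrightarrow> has_curve_derivative g (g' z) z"
    "\<And>z. z \<in> ball 0 \<rho> \<Longrightarrow> F (g z) = (\<kappa> * z) *s g' z"
proof -
  obtain \<delta> L where \<delta>: "0 < \<delta>" "\<delta> \<le> r" and L: "0 < L"
    "\<And>x y. x \<in> ball 0 \<delta> \<Longrightarrow> y \<in> ball 0 \<delta> \<Longrightarrow> norm (F x - F y) \<le> L * norm (x - y)"
    by (rule holomorphic_map_locally_lipschitz[OF hol \<open>r > 0\<close>]) blast
  \<comment> \<open>The order \<open>m\<close> of the remainder makes \<open>L / (m \<bar>\<kappa>\<bar>) \<le> 1/2\<close>, the contraction factor of the iteration.\<close>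
  obtain m0 where m0: "2 * L / cmod \<kappa> < real m0" using reals_Archimedean2 by blast
  define m where "m = Suc (Suc m0)"
  have mL: "2 * L \<le> real m * cmod \<kappa>"
  proof -
    have "2 * L \<le> real m0 * cmod \<kappa>" using m0 \<open>\<kappa> \<noteq> 0\<close> by (simp add: divide_less_eq)
    also have "\<dots> \<le> real m * cmod \<kappa>" by (simp add: m_def mult_right_mono)
    finally show ?thesis .
  qed
  have mk: "real m * cmod \<kappa> > 0" using \<open>\<kappa> \<noteq> 0\<close> by (simp add: m_def)
  have m2: "m \<ge> 2" by (simp add: m_def)
  \<comment> \<open>A formal solution of order \<open>Suc m0\<close> leaves a residual divisible by
    the next power, which is exactly \<open>z ^ m\<close>.\<close>
  obtain p p' \<rho>0 h where p: "\<And>z. has_curve_derivative p (p' z) z" "p 0 = 0" "p' 0 = v"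
    and \<rho>0: "\<rho>0 > 0" and h: "\<And>i. (\<lambda>z. h z $ i) holomorphic_on ball 0 \<rho>0"
    and R: "\<And>z. z \<in> ball 0 \<rho>0 \<Longrightarrow> F (p z) - (\<kappa> * z) *s p' z = z ^ m *s h z"
    using formal_solution[OF hol \<open>r > 0\<close> F0 v nonres, of "Suc m0"] unfolding m_def by fastforce
  have "isCont h 0"
    unfolding isCont_def
  proof (rule vec_tendstoI)
    fix i
    have "isCont (\<lambda>z. h z $ i) 0"
      using holomorphic_on_imp_continuous_on[OF h] \<rho>0 by (simp add: continuous_on_eq_continuous_at)
    then show "((\<lambda>z. h z $ i) \<longlongrightarrow> h 0 $ i) (at 0)" by (simp add: isCont_def)
  qed
  then obtain \<rho>1 where \<rho>1: "\<rho>1 > 0" "\<And>z. z \<in> ball 0 \<rho>1 \<Longrightarrow> norm (h z - h 0) < 1"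
    unfolding continuous_at_eps_delta by (metis dist_norm mem_ball_0 diff_zero zero_less_one)
  define H where "H = norm (h 0) + 1"
  have H: "H > 0" "norm (h z) \<le> H" if "z \<in> ball 0 \<rho>1" for z
    using \<rho>1(2)[OF that] norm_triangle_ineq2[of "h z" "h 0"] norm_ge_zero[of "h 0"]
    unfolding H_def by linarith+
  \<comment> \<open>Half of \<open>B\<close> accounts for the residual bound \<open>H\<close>; the
    other half for \<open>L * B\<close>, since \<open>L / (real m * cmod \<kappa>)\<close> is at
    most 1/2. This makes the class of remainders bounded by \<open>B * cmod z ^ m\<close>
    invariant.\<close>
  define B where "B = 2 * H / (real m * cmod \<kappa>)"
  have B: "B > 0" using H(1)[of 0] \<rho>1(1) mk by (simp add: B_def)
  have Bstep: "(L * B + H) / (real m * cmod \<kappa>) \<le> B"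
  proof -
    have "H = B / 2 * (real m * cmod \<kappa>)" using m2 \<open>\<kappa> \<noteq> 0\<close> by (simp add: B_def)
    moreover have "L * B \<le> B / 2 * (real m * cmod \<kappa>)"
      using mult_left_mono[OF mL, of "B/2"] B by (simp add: mult_ac)
    ultimately show ?thesis using mk by (simp add: divide_le_eq algebra_simps)
  qed
  have "isCont p 0" using p(1) by (rule has_curve_derivative_isCont)
  then obtain \<rho>2 where \<rho>2: "\<rho>2 > 0" "\<And>z. z \<in> ball 0 \<rho>2 \<Longrightarrow> norm (p z) < \<delta>/2"
    unfolding continuous_at_eps_delta using p(2) \<delta>(1)
    by (metis dist_norm mem_ball_0 diff_zero half_gt_zero)
  \<comment> \<open>The entry \<open>1\<close> gives \<open>cmod z ^ m \<le> cmod z\<close>. The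
    entries \<open>\<rho>2\<close> and \<open>\<delta> / (2 * B)\<close> keep \<open>p z\<close> and
    the remainder below \<open>\<delta>/2\<close> each, so their sum stays where the Lipschitz bound
    holds.\<close>
  define \<rho> where "\<rho> = Min {\<rho>0, \<rho>1, \<rho>2, 1, \<delta> / (2 * B)}"
  have \<rho>: "\<rho> > 0" "\<rho> \<le> \<rho>0" "\<rho> \<le> \<rho>1" "\<rho> \<le> \<rho>2" "\<rho> \<le> 1" "\<rho> \<le> \<delta> / (2 * B)"
    unfolding \<rho>_def using \<rho>0 \<rho>1 \<rho>2 \<delta> B by auto
  define U where "U = (ball 0 \<rho> :: complex set)"
  have U: "z \<in> ball 0 \<rho>0" "z \<in> ball 0 \<rho>1" "z \<in> ball 0 \<rho>2" "cmod z < 1" "cmod z < \<delta> / (2 * B)" if "z \<in> U" for z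
    using that \<rho> by (auto simp: U_def)
  have U0: "0 \<in> U" using \<rho> by (simp add: U_def)
  have pow: "cmod z ^ m \<le> cmod z" if "z \<in> U" for z
    using power_decreasing[of 1 m "cmod z"] U(4)[OF that] m2 by simp
  have in\<delta>: "p z + x \<in> ball 0 \<delta>" if "z \<in> U" "norm x \<le> B * cmod z ^ m" for z x
  proof -
    have "norm x \<le> B * cmod z"
      using that(2) mult_left_mono[OF pow[OF that(1)], of B] B by linarith
    also have "\<dots> < \<delta>/2" using U(5)[OF that(1)] B by (simp add: field_simps)
    finally show ?thesis
      using \<rho>2(2)[OF U(3)[OF that(1)]] norm_triangle_ineq[of "p z" x] by simp
  qed
  note pi = has_curve_derivative_holomorphic(1)[OF open_UNIV p(1)]
    and p'i = has_curve_derivative_holomorphic(2)[OF open_UNIV p(1)]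

  \<comment> \<open>An iterate is a curve paired with its derivative. Successive iterates are linked
    by a relation rather than a function, so that dependent choice produces the sequence.\<close>
  define adm where "adm = (\<lambda>W :: (complex \<Rightarrow> complex ^ 'n) \<times> (complex \<Rightarrow> complex ^ 'n). (\<forall>z\<in>U. has_curve_derivative (fst W) (snd W z) z) \<and> fst W 0 = 0 \<and>
    (\<forall>z\<in>U. norm (fst W z) \<le> B * cmod z ^ m))"
  define nxt where "nxt = (\<lambda>(W :: (complex \<Rightarrow> complex ^ 'n) \<times> (complex \<Rightarrow> complex ^ 'n)) (W2 :: (complex \<Rightarrow> complex ^ 'n) \<times> (complex \<Rightarrow> complex ^ 'n)). \<forall>z\<in>U. (\<kappa> * z) *s snd W2 z = F (p z + fst W z) - (\<kappa> * z) *s p' z)"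
  have "\<exists>W2. adm W2 \<and> nxt W W2" if W: "adm W" for W
  proof -
    define w where "w = fst W"
    have w: "\<And>z. z \<in> U \<Longrightarrow> has_curve_derivative w (snd W z) z" "w 0 = 0"
      "\<And>z. z \<in> U \<Longrightarrow> norm (w z) \<le> B * cmod z ^ m"
      using W by (auto simp: adm_def w_def)
    define N where "N = (\<lambda>z. F (p z + w z) - (\<kappa> * z) *s p' z)"
    have Ni: "(\<lambda>z. N z $ i) holomorphic_on ball 0 \<rho>" for i
    proof -
      have "(\<lambda>z. F (p z + w z) $ i) holomorphic_on U"
      proof (rule holomorphic_on_compose_curve[of "\<lambda>x. F x $ i" "ball 0 r" _ "\<lambda>z. p z + w z"])
        show "holomorphic_fun_on (\<lambda>x. F x $ i) (ball 0 r)"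
          using hol by (simp add: holomorphic_map_on_def)
        show "(\<lambda>z. (p z + w z) $ j) holomorphic_on U" for j
        proof -
          have "(\<lambda>z. w z $ j) holomorphic_on U"
            using w(1) by (intro has_curve_derivative_holomorphic) (auto simp: U_def)
          then show ?thesis
            using holomorphic_on_subset[OF pi] by (auto intro!: holomorphic_intros)
        qed
        show "p z + w z \<in> ball 0 r" if "z \<in> U" for z
          using in\<delta>[OF that w(3)[OF that]] \<delta>(2) by simp
      qed (simp add: U_def)
      then show ?thesis
        unfolding N_def vector_minus_component vector_smult_component U_def
        by (intro holomorphic_intros holomorphic_on_subset[OF p'i]) auto
    qed
    have N0: "N 0 = 0" using w(2) p(2) F0 by (simp add: N_def)
    have Nb: "norm (N z) \<le> (L * B + H) * cmod z ^ m" if z: "z \<in> U" for z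
    proof -
      \<comment> \<open>The first summand is controlled by the Lipschitz constant, the second is the
        residual of the formal solution.\<close>
      have "N z = (F (p z + w z) - F (p z + 0)) + z ^ m *s h z"
        using R[OF U(1)[OF z]] by (simp add: N_def algebra_simps)
      then have "norm (N z) \<le> norm (F (p z + w z) - F (p z + 0)) + norm (z ^ m *s h z)"
        by (simp only: norm_triangle_ineq)
      also have "norm (F (p z + w z) - F (p z + 0)) \<le> L * norm ((p z + w z) - (p z + 0))"
        using z w(3)[OF z] B by (intro L(2) in\<delta>) auto
      also have "\<dots> \<le> L * (B * cmod z ^ m)" using w(3)[OF z] L(1) by simp
      also have "norm (z ^ m *s h z) \<le> cmod z ^ m * H"
        using H(2)[OF U(2)[OF z]] by (simp add: norm_vector_smult_complex norm_power mult_left_mono)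
      finally show ?thesis by (simp add: algebra_simps)
    qed
    obtain w2 w2' where w2: "\<And>z. z \<in> ball 0 \<rho> \<Longrightarrow> has_curve_derivative w2 (w2' z) z" "w2 0 = 0"
      "\<And>z. z \<in> ball 0 \<rho> \<Longrightarrow> (\<kappa> * z) *s w2' z = N z"
      by (rule euler_primitive_exists[OF Ni N0 \<rho>(1) \<open>\<kappa> \<noteq> 0\<close>]) blast
    have "norm (w2 z) \<le> B * cmod z ^ m" if z: "z \<in> U" for z
    proof -
      have "norm (w2 z) \<le> (L * B + H) / (real m * cmod \<kappa>) * cmod z ^ m"
        using w2 Nb z m2 \<open>\<kappa> \<noteq> 0\<close> unfolding U_def
        by (intro euler_primitive_bound[of \<rho> w2 w2' \<kappa>]) auto
      also have "\<dots> \<le> B * cmod z ^ m" using Bstep by (intro mult_right_mono) auto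
      finally show ?thesis .
    qed
    then have "adm (w2, w2')" "nxt W (w2, w2')"
      using w2 by (auto simp: adm_def nxt_def U_def N_def w_def)
    then show ?thesis by blast
  qed
  moreover have "adm (\<lambda>_. 0, \<lambda>_. 0)"
    using B by (auto simp: adm_def has_curve_derivative_def)
  ultimately obtain S where S: "\<And>n. adm (S n)" "\<And>n. nxt (S n) (S (Suc n))"
    using dependent_nat_choice[of "\<lambda>_. adm" "\<lambda>_. nxt"] by metis
  define W W' where "W = (\<lambda>n. fst (S n))" and "W' = (\<lambda>n. snd (S n))"
  have W: "\<And>n z. z \<in> U \<Longrightarrow> has_curve_derivative (W n) (W' n z) z" "\<And>n. W n 0 = 0"
    "\<And>n z. z \<in> U \<Longrightarrow> norm (W n z) \<le> B * cmod z ^ m"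
    using S(1) by (auto simp: adm_def W_def W'_def)
  have Weq: "(\<kappa> * z) *s W' (Suc n) z = F (p z + W n z) - (\<kappa> * z) *s p' z" if "z \<in> U" for n z
    using S(2)[of n] that by (auto simp: nxt_def W_def W'_def)
  define D where "D = (\<lambda>n z. W (Suc n) z - W n z)"
  \<comment> \<open>The base case adds two admissible bounds. Afterwards the Lipschitz bound and the
    Euler gain together contribute \<open>L / (real m * cmod \<kappa>)\<close>, at most 1/2.\<close>
  have D: "norm (D n z) \<le> 2 * B * (1/2) ^ n * cmod z ^ m" if "z \<in> U" for n z
    using that
  proof (induction n arbitrary: z)
    case 0
    have "norm (D 0 z) \<le> norm (W (Suc 0) z) + norm (W 0 z)" by (simp add: D_def norm_triangle_ineq4)
    also have "\<dots> \<le> B * cmod z ^ m + B * cmod z ^ m" using W(3) 0 by (intro add_mono) auto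
    finally show ?case by simp
  next
    case (Suc n)
    have "norm (D (Suc n) z) \<le> L * (2 * B * (1/2) ^ n) / (real m * cmod \<kappa>) * cmod z ^ m"
    proof (rule euler_primitive_bound)
      show "has_curve_derivative (D (Suc n)) (W' (Suc (Suc n)) x - W' (Suc n) x) x" if "x \<in> ball 0 \<rho>" for x
        using W(1)[of x] that unfolding has_curve_derivative_def D_def U_def
        by (auto intro!: derivative_intros)
      show "norm ((\<kappa> * x) *s (W' (Suc (Suc n)) x - W' (Suc n) x)) \<le> L * (2 * B * (1/2) ^ n) * cmod x ^ m"
        if "x \<in> ball 0 \<rho>" for x
      proof -
        have x: "x \<in> U" using that by (simp add: U_def)
        have "(\<kappa> * x) *s (W' (Suc (Suc n)) x - W' (Suc n) x) =
            (\<kappa> * x) *s W' (Suc (Suc n)) x - (\<kappa> * x) *s W' (Suc n) x"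
          by (simp add: vec_eq_iff algebra_simps)
        also have "\<dots> = F (p x + W (Suc n) x) - F (p x + W n x)"
          by (simp add: Weq[OF x])
        also have "norm \<dots> \<le> L * norm ((p x + W (Suc n) x) - (p x + W n x))"
          using x W(3) by (intro L(2) in\<delta>) auto
        also have "\<dots> = L * norm (D n x)" by (simp add: D_def)
        also have "\<dots> \<le> L * (2 * B * (1/2) ^ n * cmod x ^ m)"
          using Suc.IH[OF x] L(1) by simp
        finally show ?thesis by (simp add: mult_ac)
      qed
      show "z \<in> ball 0 \<rho>" using Suc.prems by (simp add: U_def)
    qed (use m2 \<open>\<kappa> \<noteq> 0\<close> W(2) in \<open>auto simp: D_def\<close>)
    also have "\<dots> \<le> 2 * B * (1/2) ^ Suc n * cmod z ^ m"
    proof (rule mult_right_mono)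
      have "L * (2 * B * (1/2) ^ n) = 2 * L * (B * (1/2) ^ n)" by simp
      also have "\<dots> \<le> real m * cmod \<kappa> * (B * (1/2) ^ n)"
        using mL B by (intro mult_right_mono) auto
      finally show "L * (2 * B * (1/2) ^ n) / (real m * cmod \<kappa>) \<le> 2 * B * (1/2) ^ Suc n"
        using mk by (simp add: divide_le_eq mult_ac)
    qed simp
    finally show ?case .
  qed
  \<comment> \<open>The differences are dominated by a geometric series, and their sums telescope to
    the iterates.\<close>
  have "uniform_limit U (\<lambda>n z. \<Sum>i<n. D i z) (\<lambda>z. suminf (\<lambda>i. D i z)) sequentially"
  proof (rule Weierstrass_m_test)
    show "norm (D n z) \<le> 2 * B * (1/2) ^ n" if "z \<in> U" for n z
    proof -
      have "cmod z ^ m \<le> 1" using pow[OF that] U(4)[OF that] by simp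
      then have "2 * B * (1/2) ^ n * cmod z ^ m \<le> 2 * B * (1/2) ^ n * 1"
        using B by (intro mult_left_mono) auto
      then show ?thesis using D[OF that, of n] by simp
    qed
    show "summable (\<lambda>n. 2 * B * (1/2) ^ n)"
      by (intro summable_mult summable_geometric) auto
  qed
  moreover have "(\<Sum>i<n. D i z) = W n z - W 0 z" for n z
    unfolding D_def by (rule sum_lessThan_telescope)
  ultimately have "uniform_limit U (\<lambda>n z. W n z - W 0 z) (\<lambda>z. suminf (\<lambda>i. D i z)) sequentially"
    by simp
  then have "uniform_limit U (\<lambda>n z. (W n z - W 0 z) + W 0 z)
      (\<lambda>z. suminf (\<lambda>i. D i z) + W 0 z) sequentially"
    by (intro uniform_limit_add uniform_limit_const)
  then obtain w where w: "uniform_limit U W w sequentially" by auto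
  have wlim: "(\<lambda>n. W n z) \<longlonglongrightarrow> w z" if "z \<in> U" for z
    using tendsto_uniform_limitI[OF w that] .
  have wb: "norm (w z) \<le> B * cmod z ^ m" if "z \<in> U" for z
    by (rule Lim_norm_ubound[OF _ wlim[OF that]]) (use W(3)[OF that] in auto)
  \<comment> \<open>Uniform limits of holomorphic functions are holomorphic and the derivatives
    converge too, so the limit may be taken on both sides of the iteration.\<close>
  have "\<exists>u. \<forall>z\<in>U. ((\<lambda>z. w z $ i) has_field_derivative u z) (at z) \<and> (\<lambda>n. W' n z $ i) \<longlonglongrightarrow> u z" for i
  proof (rule has_complex_derivative_uniform_sequence)
    show "open U" by (simp add: U_def)
    show "((\<lambda>z. W n z $ i) has_field_derivative W' n z $ i) (at z)" if "z \<in> U" for n z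
      using W(1)[OF that] by (simp add: has_curve_derivative_def)
    have "uniform_limit U (\<lambda>n z. W n z $ i) (\<lambda>z. w z $ i) sequentially"
      by (rule bounded_linear.uniform_limit[OF bounded_linear_vec_nth w])
    then show "\<exists>d>0. cball z d \<subseteq> U \<and> uniform_limit (cball z d) (\<lambda>n z. W n z $ i) (\<lambda>z. w z $ i) sequentially"
      if "z \<in> U" for z
      using \<open>open U\<close> that by (meson open_contains_cball uniform_limit_on_subset)
  qed
  then have "\<exists>u. \<forall>i. \<forall>z\<in>U. ((\<lambda>z. w z $ i) has_field_derivative u i z) (at z) \<and> (\<lambda>n. W' n z $ i) \<longlonglongrightarrow> u i z"
    by (intro choice) blast
  then obtain u where u: "\<And>i z. z \<in> U \<Longrightarrow> ((\<lambda>z. w z $ i) has_field_derivative u i z) (at z)"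
    "\<And>i z. z \<in> U \<Longrightarrow> (\<lambda>n. W' n z $ i) \<longlonglongrightarrow> u i z"
    by blast
  have eq: "F (p z + w z) $ i = \<kappa> * z * (p' z $ i + u i z)" if z: "z \<in> U" for z i
  proof -
    have "(\<lambda>n. F (p z + W n z)) \<longlonglongrightarrow> F (p z + w z)"
    proof (rule Lim_transform_bound[of _ "\<lambda>n. L *\<^sub>R (W n z - w z)", THEN Lim_null[THEN iffD2]])
      show "\<forall>\<^sub>F n in sequentially. norm (F (p z + W n z) - F (p z + w z)) \<le> norm (L *\<^sub>R (W n z - w z))"
      proof (rule always_eventually, rule allI)
        fix n
        have "norm (F (p z + W n z) - F (p z + w z)) \<le> L * norm ((p z + W n z) - (p z + w z))"
          using z W(3) wb by (intro L(2) in\<delta>) auto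
        then show "norm (F (p z + W n z) - F (p z + w z)) \<le> norm (L *\<^sub>R (W n z - w z))"
          using L(1) by simp
      qed
      show "(\<lambda>n. L *\<^sub>R (W n z - w z)) \<longlonglongrightarrow> 0"
        using tendsto_scaleR[OF tendsto_const Lim_null[THEN iffD1, OF wlim[OF z]]] by simp
    qed
    then have "(\<lambda>n. F (p z + W n z) $ i) \<longlonglongrightarrow> F (p z + w z) $ i" by (rule tendsto_vec_nth)
    moreover have "F (p z + W n z) $ i = \<kappa> * z * (p' z $ i + W' (Suc n) z $ i)" for n
    proof -
      have "F (p z + W n z) = (\<kappa> * z) *s W' (Suc n) z + (\<kappa> * z) *s p' z"
        using Weq[OF z, of n] by (simp add: algebra_simps)
      then show ?thesis by (simp add: algebra_simps)
    qed
    moreover have "(\<lambda>n. \<kappa> * z * (p' z $ i + W' (Suc n) z $ i)) \<longlonglongrightarrow> \<kappa> * z * (p' z $ i + u i z)"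
      by (intro tendsto_intros LIMSEQ_Suc u(2) z)
    ultimately show ?thesis using LIMSEQ_unique by simp
  qed
  have w0: "w 0 = 0" using wb[OF U0] m2 by (simp add: power_0_left)
  \<comment> \<open>Because \<open>m\<close> is at least 2, the remainder is
    \<open>O(z\<^sup>2)\<close> and leaves the tangent vector \<open>v\<close> of \<open>p\<close>
    unchanged.\<close>
  have u0: "u i 0 = 0" for i
  proof -
    have "((\<lambda>x. (w x $ i - w 0 $ i) / (x - 0)) \<longlongrightarrow> 0) (at 0)"
    proof (rule Lim_null_comparison)
      have "\<forall>\<^sub>F z in at 0. z \<in> U" using U0 by (intro eventually_at_in_open') (auto simp: U_def)
      moreover have "\<forall>\<^sub>F z in at (0::complex). z \<noteq> 0" by (simp add: eventually_at_filter)
      ultimately show "\<forall>\<^sub>F z in at 0. norm ((w z $ i - w 0 $ i) / (z - 0)) \<le> B * cmod z"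
      proof eventually_elim
        case (elim z)
        have "cmod (w z $ i) \<le> B * cmod z ^ m"
          using wb[OF elim(1)] Finite_Cartesian_Product.norm_nth_le[of "w z" i] by linarith
        also have "\<dots> \<le> B * cmod z ^ 2"
          using B m2 U(4)[OF elim(1)] by (intro mult_left_mono power_decreasing) auto
        finally show ?case
          using elim(2) w0 by (simp add: norm_divide divide_le_eq power2_eq_square mult_ac)
      qed
      show "((\<lambda>z. B * cmod z) \<longlongrightarrow> 0) (at 0)"
        by (auto intro!: tendsto_eq_intros)
    qed
    then have "((\<lambda>z. w z $ i) has_field_derivative 0) (at 0)"
      by (simp add: has_field_derivative_iff)
    then show ?thesis using u(1)[OF U0] DERIV_unique by blast
  qed
  show thesis
  proof (rule that[of \<rho> "\<lambda>z. p z + w z" "\<lambda>z. p' z + (\<chi> i. u i z)"])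
    show "\<rho> > 0" by fact
    show "p 0 + w 0 = 0" using p w0 by simp
    show "p' 0 + (\<chi> i. u i 0) = v" using p u0 by (simp add: vec_eq_iff)
    fix z :: complex assume "z \<in> ball 0 \<rho>"
    then have z: "z \<in> U" by (simp add: U_def)
    show "p z + w z \<in> ball 0 r" using in\<delta>[OF z wb[OF z]] \<delta>(2) by simp
    show "has_curve_derivative (\<lambda>z. p z + w z) (p' z + (\<chi> i. u i z)) z"
      using p(1) u(1)[OF z] unfolding has_curve_derivative_def by (auto intro!: derivative_intros)
    show "F (p z + w z) = (\<kappa> * z) *s (p' z + (\<chi> i. u i z))"
      using eq[OF z] by (simp add: vec_eq_iff distrib_left)
  qed
qed

subsection \<open>Graphs of holomorphic functions over one coordinate\<close>

lemma holomorphic_fun_on_coordinate: "holomorphic_fun_on (\<lambda>x. x $ i) S"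
  unfolding holomorphic_fun_on_def clinear_iff
  by (intro ballI exI[of _ "\<lambda>x. x $ i"])
    (auto intro: bounded_linear_imp_has_derivative bounded_linear_vec_nth)

lemma holomorphic_fun_on_const: "holomorphic_fun_on (\<lambda>x. c) S"
  unfolding holomorphic_fun_on_def clinear_iff
  by (intro ballI exI[of _ "\<lambda>x. 0"]) auto

lemma holomorphic_fun_on_add:
  assumes "holomorphic_fun_on f S" "holomorphic_fun_on g S"
  shows "holomorphic_fun_on (\<lambda>x. f x + g x) S"
  unfolding holomorphic_fun_on_def
proof
  fix x assume "x \<in> S"
  then obtain D E where
    "Vector_Spaces.linear (*s) (*) D" "(f has_derivative D) (at x)"
    "Vector_Spaces.linear (*s) (*) E" "(g has_derivative E) (at x)"
    using assms unfolding holomorphic_fun_on_def by blast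
  then show "\<exists>D. Vector_Spaces.linear (*s) (*) D \<and> ((\<lambda>x. f x + g x) has_derivative D) (at x)"
    by (intro exI[of _ "\<lambda>h. D h + E h"]) (auto simp: clinear_iff algebra_simps intro: has_derivative_add)
qed

lemma holomorphic_fun_on_compose:
  assumes "holomorphic_fun_on f S" "u holomorphic_on T" "open T" "\<And>x. x \<in> S \<Longrightarrow> f x \<in> T"
  shows "holomorphic_fun_on (\<lambda>x. u (f x)) S"
  unfolding holomorphic_fun_on_def
proof
  fix x assume x: "x \<in> S"
  then obtain D where D: "Vector_Spaces.linear (*s) (*) D" "(f has_derivative D) (at x)"
    using assms unfolding holomorphic_fun_on_def by blast
  have "(u has_derivative (*) (deriv u (f x))) (at (f x))"
    using holomorphic_derivI[OF assms(2,3)] assms(4)[OF x] by (simp add: has_field_derivative_def)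
  then have "((\<lambda>x. u (f x)) has_derivative (\<lambda>h. deriv u (f x) * D h)) (at x)"
    by (rule has_derivative_compose[OF D(2)])
  moreover have "Vector_Spaces.linear (*s) (*) (\<lambda>h. deriv u (f x) * D h)"
    using D(1) by (simp add: clinear_iff algebra_simps)
  ultimately show "\<exists>D. Vector_Spaces.linear (*s) (*) D \<and> ((\<lambda>x. u (f x)) has_derivative D) (at x)"
    by blast
qed

lemma holomorphic_fun_on_uminus:
  "holomorphic_fun_on f S \<Longrightarrow> holomorphic_fun_on (\<lambda>x. - f x) S"
  by (rule holomorphic_fun_on_compose[of f S uminus UNIV]) (auto intro!: holomorphic_intros)

lemma holomorphic_fun_on_diff:
  "holomorphic_fun_on f S \<Longrightarrow> holomorphic_fun_on g S \<Longrightarrow> holomorphic_fun_on (\<lambda>x. f x - g x) S"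
  using holomorphic_fun_on_add[of f S "\<lambda>x. - g x"] holomorphic_fun_on_uminus[of g S] by simp

lemma holomorphic_map_on_continuous_on:
  fixes F :: "complex ^ 'n \<Rightarrow> complex ^ 'n"
  shows "holomorphic_map_on F S \<Longrightarrow> continuous_on S F"
  by (meson continuous_at_imp_continuous_on has_derivative_continuous has_derivative_jacobian_matrix)

text \<open>The curve \<open>k\<close> is parametrised by its own \<open>j\<close>-th coordinate. In
  the application \<open>k\<close> is the invariant curve composed with the inverse of its
  \<open>j\<close>-th component.\<close>

locale holomorphic_graph =
  fixes k :: "complex \<Rightarrow> complex ^ 'n" and T :: "complex set" and j :: 'n
    and U :: "(complex ^ 'n) set"
  assumes open_T: "open T" and hol_k: "\<And>i. (\<lambda>s. k s $ i) holomorphic_on T"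
    and k_nth: "\<And>s. s \<in> T \<Longrightarrow> k s $ j = s"
    and open_U: "open U" and U_nth: "\<And>x. x \<in> U \<Longrightarrow> x $ j \<in> T"
begin

text \<open>The fixed-point form exhibits the graph as a zero set of holomorphic functions, one for
  each coordinate.\<close>

definition V :: "(complex ^ 'n) set" where "V = {x \<in> U. k (x $ j) = x}"

lemma holomorphic_k_nth:
  "(\<And>x. x \<in> S \<Longrightarrow> x $ j \<in> T) \<Longrightarrow> holomorphic_fun_on (\<lambda>x. k (x $ j) $ i) S"
  by (rule holomorphic_fun_on_compose[OF holomorphic_fun_on_coordinate hol_k open_T])

lemma analytic_V: "analytic_subset U V"
proof -
  define Fs where "Fs = range (\<lambda>i (x :: complex ^ 'n). k (x $ j) $ i - x $ i)"
  have "finite Fs" by (simp add: Fs_def)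
  moreover have "holomorphic_fun_on f U" if "f \<in> Fs" for f
    using that U_nth unfolding Fs_def
    by (auto intro!: holomorphic_fun_on_diff holomorphic_fun_on_coordinate holomorphic_k_nth)
  moreover have "V \<inter> U = {x \<in> U. \<forall>f\<in>Fs. f x = 0}"
  proof -
    have "k (x $ j) = x \<longleftrightarrow> (\<forall>f\<in>Fs. f x = 0)" for x
      unfolding Fs_def vec_eq_iff by simp
    then show ?thesis by (auto simp: V_def)
  qed
  moreover have "V \<subseteq> U" by (auto simp: V_def)
  ultimately show ?thesis
    unfolding analytic_subset_def using open_U
    by (intro conjI ballI exI[of _ U] exI[of _ Fs]) blast+
qed

text \<open>The shear \<open>\<phi>\<close> subtracts the point of the graph over
  \<open>x $ j\<close> and restores the \<open>j\<close>-th coordinate. It flattens \<open>V\<close>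
  onto the \<open>j\<close>-th axis, and adding the point back inverts it.\<close>

lemma regular_V:
  assumes "q \<in> V"
  shows "regular_point V 1 q"
proof -
  define \<phi> where "\<phi> = (\<lambda>x. x - k (x $ j) + axis j (x $ j))"
  define \<psi> where "\<psi> = (\<lambda>y. y + k (y $ j) - axis j (y $ j))"
  define Z where "Z = {y :: complex ^ 'n. y $ j \<in> T}"
  have axis: "holomorphic_fun_on (\<lambda>x. axis j (x $ j) $ i) S" for i and S :: "(complex ^ 'n) set"
    by (cases "i = j") (simp_all add: axis_def holomorphic_fun_on_coordinate holomorphic_fun_on_const)
  have hol\<phi>: "holomorphic_map_on \<phi> U"
    unfolding holomorphic_map_on_def \<phi>_def vector_add_component vector_minus_component
    using U_nth by (intro allI holomorphic_fun_on_add holomorphic_fun_on_diff axis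
        holomorphic_fun_on_coordinate holomorphic_k_nth)
  have hol\<psi>: "holomorphic_map_on \<psi> Z"
    unfolding holomorphic_map_on_def \<psi>_def vector_add_component vector_minus_component
    by (intro allI holomorphic_fun_on_add holomorphic_fun_on_diff axis
        holomorphic_fun_on_coordinate holomorphic_k_nth) (simp add: Z_def)
  have \<phi>j: "\<phi> x $ j = x $ j" if "x $ j \<in> T" for x
    using k_nth[OF that] by (simp add: \<phi>_def)
  have \<psi>j: "\<psi> x $ j = x $ j" if "x $ j \<in> T" for x
    using k_nth[OF that] by (simp add: \<psi>_def)
  have \<psi>\<phi>: "\<psi> (\<phi> x) = x" if "x $ j \<in> T" for x
    using \<phi>j[OF that] by (simp add: \<psi>_def) (simp add: \<phi>_def)
  have \<phi>\<psi>: "\<phi> (\<psi> x) = x" if "x $ j \<in> T" for x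
    using \<psi>j[OF that] by (simp add: \<phi>_def) (simp add: \<psi>_def)
  \<comment> \<open>Writing the image as a preimage under the continuous inverse shows that it is
    open.\<close>
  have image: "\<phi> ` U = Z \<inter> \<psi> -` U"
  proof (intro equalityI subsetI)
    fix y assume "y \<in> \<phi> ` U"
    then show "y \<in> Z \<inter> \<psi> -` U" using U_nth by (auto simp: Z_def \<phi>j \<psi>\<phi>)
  next
    fix y assume "y \<in> Z \<inter> \<psi> -` U"
    then show "y \<in> \<phi> ` U" using \<phi>\<psi>[of y] by (auto simp: Z_def intro!: image_eqI[of _ _ "\<psi> y"])
  qed
  have "open Z"
    using open_vimage_vec_nth[OF open_T, of j] by (simp add: Z_def vimage_def)
  then have "open (\<phi> ` U)"
    unfolding image
    by (rule continuous_open_preimage[OF holomorphic_map_on_continuous_on[OF hol\<psi>] _ open_U])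
  moreover have "holomorphic_map_on \<psi> (\<phi> ` U)"
    using hol\<psi> unfolding image holomorphic_map_on_def holomorphic_fun_on_def by blast
  ultimately have "biholomorphic_on \<phi> U"
    unfolding biholomorphic_on_def using hol\<phi> \<psi>\<phi> U_nth by blast
  moreover have "\<phi> ` (V \<inter> U) = {y \<in> \<phi> ` U. \<forall>i. i \<notin> {j} \<longrightarrow> y $ i = 0}"
  proof -
    have "x \<in> V \<longleftrightarrow> (\<forall>i. i \<notin> {j} \<longrightarrow> \<phi> x $ i = 0)" if "x \<in> U" for x
    proof -
      have "\<phi> x $ i = x $ i - k (x $ j) $ i" if "i \<noteq> j" for i
        using that by (simp add: \<phi>_def axis_def)
      moreover have "k (x $ j) $ j = x $ j" using k_nth U_nth that by blast
      ultimately show ?thesis using that by (auto simp: V_def vec_eq_iff) (metis)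
    qed
    then show ?thesis by blast
  qed
  ultimately show ?thesis
    unfolding regular_point_def using assms open_U
    by (intro conjI exI[of _ U] exI[of _ \<phi>] exI[of _ "{j}"]) (auto simp: V_def)
qed

text \<open>In a chart with two free directions, some nonzero combination of them would be annihilated by
  the differential of the \<open>j\<close>-th coordinate, although that coordinate parametrises \<open>V\<close>.\<close>

lemma regular_V_dim_le_1:
  assumes "regular_point V d q"
  shows "d \<le> 1"
proof -
  obtain W \<phi> I where W: "open W" "q \<in> W" "q \<in> V" and bi: "biholomorphic_on \<phi> W"
    and card: "card I = d" and I: "\<phi> ` (V \<inter> W) = {y \<in> \<phi> ` W. \<forall>i. i \<notin> I \<longrightarrow> y $ i = 0}"
    using assms unfolding regular_point_def by blast
  obtain \<psi> where \<psi>: "holomorphic_map_on \<psi> (\<phi> ` W)" "\<And>x. x \<in> W \<Longrightarrow> \<psi> (\<phi> x) = x"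
    and \<phi>: "holomorphic_map_on \<phi> W" "open (\<phi> ` W)"
    using bi unfolding biholomorphic_on_def by blast
  define y where "y = \<phi> q"
  have y: "y \<in> \<phi> ` W" "\<psi> y = q" "\<And>i. i \<notin> I \<Longrightarrow> y $ i = 0"
    using W \<psi>(2) I by (auto simp: y_def)
  define J where "J = jacobian_matrix \<psi> y"
  \<comment> \<open>Near \<open>0\<close> the line \<open>c\<close> through \<open>y\<close> in
    direction \<open>w\<close> runs in the flattened \<open>V\<close>, so it is recovered from the
    \<open>j\<close>-th coordinate of \<open>\<psi> (c t)\<close> through \<open>k\<close> and
    \<open>\<phi>\<close>. That coordinate has derivative zero at \<open>0\<close>, hence so has
    \<open>c\<close>.\<close>
  have flat: "w = 0" if w: "(J *v w) $ j = 0" "\<And>i. i \<notin> I \<Longrightarrow> w $ i = 0" for w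
  proof -
    define c where "c = (\<lambda>t :: complex. y + t *s w)"
    have c: "(c has_derivative (\<lambda>h. h *s w)) (at t)" for t
      unfolding has_curve_derivative_iff[symmetric] has_curve_derivative_def c_def
      by (auto intro!: derivative_eq_intros)
    have c0: "c 0 = y" by (simp add: c_def)
    have "((\<lambda>t. \<psi> (c t)) has_derivative (\<lambda>h. J *v (h *s w))) (at 0)"
      using has_derivative_compose[OF c[of 0], of \<psi>] has_derivative_jacobian_matrix[OF \<psi>(1) y(1)]
      by (simp add: c0 J_def)
    then have "((\<lambda>t. \<psi> (c t) $ j) has_derivative (\<lambda>h. (J *v (h *s w)) $ j)) (at 0)"
      by (rule bounded_linear.has_derivative[OF bounded_linear_vec_nth])
    then have s: "((\<lambda>t. \<psi> (c t) $ j) has_derivative (\<lambda>h. 0)) (at 0)"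
      using w(1) by (simp add: vector_scalar_commute)
    have q: "q $ j \<in> T" "k (q $ j) = q" using W(3) U_nth by (auto simp: V_def)
    define k' where "k' = (\<chi> i. deriv (\<lambda>s. k s $ i) (q $ j))"
    have "has_curve_derivative k k' (q $ j)"
      unfolding has_curve_derivative_def k'_def
      using holomorphic_derivI[OF hol_k open_T q(1)] by simp
    then have "(k has_derivative (\<lambda>h. h *s k')) (at (\<psi> (c 0) $ j))"
      by (simp add: c0 y(2) has_curve_derivative_iff)
    from has_derivative_compose[OF s this]
    have ks: "((\<lambda>t. k (\<psi> (c t) $ j)) has_derivative (\<lambda>h. 0)) (at 0)" by simp
    have "(\<phi> has_derivative (*v) (jacobian_matrix \<phi> q)) (at (k (\<psi> (c 0) $ j)))"
      using has_derivative_jacobian_matrix[OF \<phi>(1) W(2)] by (simp add: c0 y(2) q(2))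
    from has_derivative_compose[OF ks this]
    have 0: "((\<lambda>t. \<phi> (k (\<psi> (c t) $ j))) has_derivative (\<lambda>h. 0)) (at 0)" by simp
    define O' where "O' = c -` (\<phi> ` W)"
    have "continuous_on UNIV c"
      using c by (meson continuous_at_imp_continuous_on has_derivative_continuous)
    then have O': "open O'" "0 \<in> O'"
      using \<phi>(2) y(1) by (auto simp: O'_def c0 open_vimage)
    have "\<phi> (k (\<psi> (c t) $ j)) = c t" if "t \<in> O'" for t
    proof -
      have "c t \<in> \<phi> ` (V \<inter> W)"
        unfolding I using that w(2) y(3) by (simp add: O'_def c_def)
      then show ?thesis using \<psi>(2) by (auto simp: V_def)
    qed
    then have "(c has_derivative (\<lambda>h. 0)) (at 0)"
      using has_derivative_transform_within_open[OF 0 O'] by blast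
    from has_derivative_unique[OF this c[of 0]] have "1 *s w = 0" by metis
    then show "w = 0" by simp
  qed
  have "a = b" if ab: "a \<in> I" "b \<in> I" for a b
  proof (rule ccontr)
    assume "a \<noteq> b"
    define \<alpha> \<beta> where "\<alpha> = (J *v axis a 1) $ j" and "\<beta> = (J *v axis b 1) $ j"
    \<comment> \<open>This combination lies in the kernel of the differential whatever
      \<open>\<alpha>\<close> and \<open>\<beta>\<close> are. Its vanishing forces
      \<open>\<alpha> = 0\<close>, and then \<open>axis a 1\<close> itself lies in the kernel, a
      contradiction.\<close>
    define w where "w = \<alpha> *s axis b 1 - \<beta> *s axis a 1"
    have off: "axis a 1 $ i = 0" "axis b 1 $ i = 0" if "i \<notin> I" for i
      using that ab by (auto simp: axis_def)
    have "(J *v w) $ j = 0"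
      by (simp add: w_def matrix_vector_mult_diff_distrib vector_scalar_commute \<alpha>_def \<beta>_def)
    then have "w = 0" by (rule flat) (simp add: w_def off)
    then have "w $ b = 0" by simp
    then have "\<alpha> = 0" using \<open>a \<noteq> b\<close> by (simp add: w_def axis_def)
    then have "(axis a 1 :: complex ^ 'n) = 0" by (intro flat) (auto simp: \<alpha>_def off)
    then show False by (metis axis_nth zero_index zero_neq_one)
  qed
  then show ?thesis
    using card_le_Suc0_iff_eq[of I] card by auto
qed

lemma pure_dimensional_V: "pure_dimensional V 1"
  unfolding pure_dimensional_def has_dimension_at_def
proof (intro ballI conjI allI impI)
  fix p assume "p \<in> V"
  then show "p \<in> closure {q. regular_point V 1 q}"
    using regular_V closure_subset by blast
  fix d' :: nat assume "1 < d'"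
  then have "{q. regular_point V d' q} = {}" using regular_V_dim_le_1 by fastforce
  then show "p \<notin> closure {q. regular_point V d' q}" by simp
qed

end

subsection \<open>Periodic orbits\<close>

text \<open>The curve \<open>g\<close> carries the rotation
  \<open>z \<mapsto> z * cis (\<omega> * t)\<close> to solutions of the system, and its injectivity
  transfers the least period of the rotation to the orbit.\<close>

lemma periodic_orbit_linearised:
  fixes g :: "complex \<Rightarrow> complex ^ 'n"
  assumes "\<omega> \<noteq> 0" and c: "c \<in> ball 0 \<sigma>" "c \<noteq> 0" and inj: "inj_on g (ball 0 \<sigma>)"
    and g: "\<And>z. z \<in> ball 0 \<sigma> \<Longrightarrow> g z \<in> \<Delta>"
    "\<And>z. z \<in> ball 0 \<sigma> \<Longrightarrow> has_curve_derivative g (g' z) z"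
    "\<And>z. z \<in> ball 0 \<sigma> \<Longrightarrow> F (g z) = (of_real \<omega> * \<i> * z) *s g' z"
  shows "periodic_orbit \<Delta> F (2 * pi / \<bar>\<omega>\<bar>) (range (\<lambda>t. g (c * cis (\<omega> * t))))"
proof -
  define x where "x = (\<lambda>t. g (c * cis (\<omega> * t)))"
  define P where "P = 2 * pi / \<bar>\<omega>\<bar>"
  have P: "P > 0" using \<open>\<omega> \<noteq> 0\<close> by (simp add: P_def)
  have mem: "c * cis (\<omega> * t) \<in> ball 0 \<sigma>" for t using c by (simp add: norm_mult)
  have "(x has_vector_derivative F (x t)) (at t)" for t
  proof -
    define z where "z = c * cis (\<omega> * t)"
    have "((\<lambda>t. c * cis (\<omega> * t)) has_vector_derivative of_real \<omega> * \<i> * z) (at t)"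
    proof -
      have "((\<lambda>u. c * exp (\<i> * of_real \<omega> * u)) has_field_derivative of_real \<omega> * \<i> * z) (at (of_real t))"
        by (auto intro!: derivative_eq_intros simp: z_def cis_conv_exp mult_ac)
      from has_vector_derivative_real_field[OF this] show ?thesis
        by (simp add: cis_conv_exp mult_ac)
    qed
    then have "((\<lambda>t. c * cis (\<omega> * t)) has_derivative (\<lambda>h. h *\<^sub>R (of_real \<omega> * \<i> * z))) (at t)"
      by (simp add: has_vector_derivative_def)
    moreover have "(g has_derivative (\<lambda>h. h *s g' z)) (at (c * cis (\<omega> * t)))"
      using g(2)[OF mem[of t]] by (simp add: has_curve_derivative_iff z_def)
    ultimately have "(x has_derivative (\<lambda>h. (h *\<^sub>R (of_real \<omega> * \<i> * z)) *s g' z)) (at t)"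
      unfolding x_def by (rule has_derivative_compose)
    moreover have "(h *\<^sub>R (of_real \<omega> * \<i> * z)) *s g' z = h *\<^sub>R F (x t)" for h
      using g(3)[OF mem[of t]]
      by (simp add: vec_eq_iff x_def z_def scaleR_conv_of_real[where 'a=complex] mult_ac)
    ultimately show ?thesis by (simp add: has_vector_derivative_def)
  qed
  then have "global_solution \<Delta> F x"
    using g(1) mem by (simp add: global_solution_def x_def)
  moreover have period: "least_positive_period x P"
    unfolding least_positive_period_def
  proof (intro conjI allI impI P)
    fix t
    have "cis (\<omega> * (t + P)) = cis (\<omega> * t) * cis (\<omega> * P)" by (simp add: cis_mult distrib_left)
    moreover have "cis (\<omega> * P) = 1"
    proof (cases "\<omega> > 0")
      case False
      then have "\<omega> * P = - (2 * pi)" using \<open>\<omega> \<noteq> 0\<close> by (simp add: P_def)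
      then show ?thesis by (simp add: cis_cnj[symmetric])
    qed (simp add: P_def)
    ultimately show "x (t + P) = x t" by (simp add: x_def)
  next
    fix S assume S: "0 < S \<and> S < P"
    show "\<not> (\<forall>t. x (t + S) = x t)"
    proof
      assume "\<forall>t. x (t + S) = x t"
      then have "x (0 + S) = x 0" by blast
      then have "c * cis (\<omega> * S) = c * cis (\<omega> * 0)"
        using inj mem[of S] mem[of 0] by (auto simp: x_def dest: inj_onD)
      then have "exp (\<i> * of_real (\<omega> * S)) = 1" using c(2) by (simp add: cis_conv_exp)
      then obtain n :: int where n: "\<omega> * S = of_int (2 * n) * pi"
        unfolding exp_eq_1 by auto
      have "\<bar>\<omega> * S\<bar> < 2 * pi" "\<omega> * S \<noteq> 0"
        using S \<open>\<omega> \<noteq> 0\<close> by (auto simp: abs_mult P_def field_simps)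
      then have "real_of_int \<bar>n\<bar> < 1" "n \<noteq> 0" unfolding n by (auto simp: abs_mult)
      then show False by linarith
    qed
  qed
  moreover have "\<not> x constant_on UNIV"
  proof
    assume "x constant_on UNIV"
    \<comment> \<open>A constant solution would also have the period \<open>P/2\<close>, against the
      minimality of \<open>P\<close>.\<close>
    then have "\<forall>t. x (t + P/2) = x t" by (auto simp: constant_on_def)
    moreover have "0 < P/2 \<and> P/2 < P" using P by simp
    ultimately show False using period unfolding least_positive_period_def by blast
  qed
  ultimately show ?thesis unfolding periodic_orbit_def x_def[symmetric] P_def[symmetric] by blast
qed

theorem theorem4:
  fixes F :: "complex ^ 'n \<Rightarrow> complex ^ 'n" and r \<omega> :: real
  assumes "r > 0"
    and "holomorphic_map_on F (ball 0 r)"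
    and "isolated_zero_of F 0"
    and "\<omega> \<noteq> 0"
    and "matrix_eigenvalue (jacobian_matrix F 0) (of_real \<omega> * \<i>)"
    and "\<And>l k. matrix_eigenvalue (jacobian_matrix F 0) l \<Longrightarrow> l \<noteq> of_real \<omega> * \<i> \<Longrightarrow>
           \<bar>k :: int\<bar> \<ge> 2 \<Longrightarrow> l / (of_real \<omega> * \<i>) \<noteq> of_int k"
  shows "\<exists>V d. local_analytic_variety_in (ball 0 r) V \<and> d \<ge> 1 \<and> pure_dimensional V d \<and>
           0 \<in> V \<and>
           (\<exists>\<C>. (\<forall>C\<in>\<C>. periodic_orbit (ball 0 r) F (2 * pi / \<bar>\<omega>\<bar>) C) \<and> V - {0} = \<Union>\<C>)"
proof -
  define \<kappa> where "\<kappa> = of_real \<omega> * \<i>"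
  have \<kappa>: "\<kappa> \<noteq> 0" using assms(4) by (simp add: \<kappa>_def)
  have F0: "F 0 = 0" using assms(3) by (simp add: isolated_zero_of_def)
  obtain v where v: "v \<noteq> 0" "jacobian_matrix F 0 *v v = \<kappa> *s v"
    using assms(5) unfolding matrix_eigenvalue_def \<kappa>_def by blast
  have nonres: "\<not> matrix_eigenvalue (jacobian_matrix F 0) (of_nat k * \<kappa>)" if "k \<ge> 2" for k
  proof
    assume "matrix_eigenvalue (jacobian_matrix F 0) (of_nat k * \<kappa>)"
    moreover have "of_nat k * \<kappa> \<noteq> \<kappa>" using that \<kappa> by simp
    moreover have "\<bar>int k\<bar> \<ge> 2" using that by simp
    ultimately have "of_nat k * \<kappa> / \<kappa> \<noteq> of_int (int k)" unfolding \<kappa>_def by (rule assms(6))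
    then show False using \<kappa> by simp
  qed
  obtain g g' \<rho> where \<rho>: "\<rho> > 0" and g0: "g 0 = 0" "g' 0 = v"
    and g: "\<And>z. z \<in> ball 0 \<rho> \<Longrightarrow> g z \<in> ball 0 r"
    "\<And>z. z \<in> ball 0 \<rho> \<Longrightarrow> has_curve_derivative g (g' z) z"
    "\<And>z. z \<in> ball 0 \<rho> \<Longrightarrow> F (g z) = (\<kappa> * z) *s g' z"
    by (rule convergent_solution[OF assms(2,1) F0 \<kappa> v(2) nonres]) blast+
  have hol_g: "(\<lambda>z. g z $ i) holomorphic_on ball 0 \<rho>" for i
    by (rule has_curve_derivative_holomorphic(1)[where p' = g']) (use g(2) in auto)
  \<comment> \<open>The \<open>j\<close>-th component of \<open>g\<close> has nonzero derivative at
    \<open>0\<close>, so on a small disc it is injective and can serve as the parameter of the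
    curve.\<close>
  obtain j where j: "v $ j \<noteq> 0" using v(1) by (auto simp: vec_eq_iff)
  have "((\<lambda>z. g z $ j) has_field_derivative v $ j) (at 0)"
    using g(2)[of 0] g0 \<rho> by (simp add: has_curve_derivative_def)
  then have dg: "deriv (\<lambda>z. g z $ j) 0 \<noteq> 0" using j by (simp add: DERIV_imp_deriv)
  have "0 \<in> ball (0 :: complex) \<rho>" using \<rho> by simp
  obtain \<sigma> where \<sigma>: "\<sigma> > 0" "ball (0 :: complex) \<sigma> \<subseteq> ball 0 \<rho>" and inj: "inj_on (\<lambda>z. g z $ j) (ball 0 \<sigma>)"
    by (rule has_complex_derivative_locally_injective[OF hol_g \<open>0 \<in> ball (0 :: complex) \<rho>\<close> open_ball dg]) blast
  define B where "B = ball (0 :: complex) \<sigma>"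
  define T where "T = (\<lambda>z. g z $ j) ` B"
  have "open B" by (simp add: B_def)
  have hol_B: "(\<lambda>z. g z $ i) holomorphic_on B" for i
    unfolding B_def by (rule holomorphic_on_subset[OF hol_g \<sigma>(2)])
  obtain h where h: "h holomorphic_on T" "\<And>z. z \<in> B \<Longrightarrow> h (g z $ j) = z"
    unfolding T_def by (rule holomorphic_has_inverse[OF hol_B \<open>open B\<close> inj[folded B_def]]) blast
  have "open T"
    unfolding T_def by (rule open_mapping_thm3[OF hol_B \<open>open B\<close> inj[folded B_def]])
  \<comment> \<open>Over each point of \<open>T\<close> the graph has exactly one point, so within
    this cylinder \<open>V\<close> is precisely the image of the disc \<open>B\<close>.\<close>
  define U where "U = ball 0 r \<inter> (\<lambda>x. x $ j) -` T"
  interpret holomorphic_graph "\<lambda>s. g (h s)" T j U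
  proof
    have "h ` T \<subseteq> B" using h(2) by (auto simp: T_def)
    then show "(\<lambda>s. g (h s) $ i) holomorphic_on T" for i
      using holomorphic_on_compose_gen[OF h(1) hol_B] by (simp add: o_def)
    show "open U"
      unfolding U_def by (intro open_Int open_vimage_vec_nth \<open>open T\<close> open_ball)
    show "g (h s) $ j = s" if "s \<in> T" for s using that h(2) by (auto simp: T_def)
  qed (auto simp: U_def \<open>open T\<close>)
  have V_iff: "x \<in> V \<longleftrightarrow> x \<in> ball 0 r \<and> x $ j \<in> T \<and> g (h (x $ j)) = x" for x
    unfolding V_def by (auto simp: U_def)
  have V: "V = g ` B"
  proof (intro equalityI subsetI)
    fix x assume "x \<in> V"
    then obtain z where z: "z \<in> B" "x $ j = g z $ j" and x: "g (h (x $ j)) = x"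
      by (auto simp: V_iff T_def)
    then have "x = g z" using h(2) by simp
    then show "x \<in> g ` B" using z(1) by blast
  next
    fix x assume "x \<in> g ` B"
    then show "x \<in> V" using g(1) \<sigma>(2) h(2) by (auto simp: V_iff T_def B_def)
  qed
  have "0 \<in> B" using \<sigma> by (simp add: B_def)
  then have "0 \<in> V" using imageI[of 0 B g] g0(1) unfolding V by simp
  have inj_g: "inj_on g B"
    using inj[folded B_def] by (auto simp: inj_on_def)
  \<comment> \<open>The orbits are the images of the circles about the origin; these circles fill
    the punctured disc.\<close>
  define \<C> where "\<C> = (\<lambda>c. range (\<lambda>t. g (c * cis (\<omega> * t)))) ` (B - {0})"
  have "periodic_orbit (ball 0 r) F (2 * pi / \<bar>\<omega>\<bar>) C" if "C \<in> \<C>" for C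
  proof -
    obtain c where c: "c \<in> B" "c \<noteq> 0" "C = range (\<lambda>t. g (c * cis (\<omega> * t)))"
      using \<open>C \<in> \<C>\<close> by (auto simp: \<C>_def)
    show ?thesis unfolding c(3)
      by (rule periodic_orbit_linearised[of \<omega> c \<sigma> g _ g'])
        (use assms(4) c inj_g g \<sigma>(2) in \<open>auto simp: B_def \<kappa>_def\<close>)
  qed
  moreover have "V - {0} = \<Union>\<C>"
  proof -
    have "V - {0} = g ` (B - {0})"
      unfolding V using inj_on_image_set_diff[OF inj_g, of B "{0}"] \<open>0 \<in> B\<close> g0 by simp
    also have "\<dots> = \<Union>\<C>"
    proof (intro equalityI subsetI)
      fix x assume "x \<in> g ` (B - {0})"
      then obtain c where c: "c \<in> B - {0}" "x = g c" by blast
      then have "x \<in> range (\<lambda>t. g (c * cis (\<omega> * t)))"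
        by (intro range_eqI[of _ _ 0]) simp
      then show "x \<in> \<Union>\<C>" using c by (auto simp: \<C>_def)
    next
      fix x assume "x \<in> \<Union>\<C>"
      then obtain c t where "c \<in> B - {0}" "x = g (c * cis (\<omega> * t))" by (auto simp: \<C>_def)
      moreover from this have "c * cis (\<omega> * t) \<in> B - {0}" by (auto simp: B_def norm_mult)
      ultimately show "x \<in> g ` (B - {0})" by blast
    qed
    finally show ?thesis .
  qed
  moreover have "local_analytic_variety_in (ball 0 r) V"
    unfolding local_analytic_variety_in_def
    using analytic_V open_U \<open>0 \<in> V\<close> by (intro exI[of _ U]) (auto simp: analytic_subset_def U_def)
  ultimately show ?thesis
    using pure_dimensional_V \<open>0 \<in> V\<close> by (intro exI[of _ V] exI[of _ 1]) auto
qed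

end
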